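(* Let $p\ge 7$ be a prime and put $\Phi=(p-2)(p-3)(p-4)(p-5)$, $\alpha=15(p-3)(p-5)$, $\beta=15(p-3)(p-5)-120$ and $\delta=2\cdot(p-4)\cdot 20-120$. Then the number of conjugacy classes (under conjugation in $\mathrm{PGL}_{6}(\mathbb{C})$) of admissible cyclic subgroups of order $p$ of $\mathrm{PGL}_{6}(\mathbb{C})$ is \begin{itemize} \item $\dfrac{\alpha}{360}+\dfrac{\Phi-\alpha}{720}$ if $p\not\equiv 1 \pmod 5$ and $p\not\equiv 1\pmod 3$; \item $1+\dfrac{\alpha}{360}+\dfrac{\Phi-144-\alpha}{720}$ if $p\equiv 1 \pmod 5$ and $p\not\equiv 1\pmod 3$; \item $1+\dfrac{\beta}{360}+\dfrac{\delta}{240}+\dfrac{\Phi-120-\beta-\delta}{720}$ if $p\not\equiv 1 \pmod 5$ and $p\equiv 1\pmod 3$; \item $2+\dfrac{\beta}{360}+\dfrac{\delta}{240}+\dfrac{\Phi-120-144-\beta-\delta}{720}$ if $p\equiv 1 \pmod 5$ and $p\equiv 1\pmod 3$. \end{itemize}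
   Context: A set of points in $\mathbb{P}^k(\mathbb{C})$ is in general position if any subset of $t\le k+1$ of its points spans a $(t-1)$-dimensional linear projective subspace. The group $\mathrm{PGL}_{k+1}(\mathbb{C})$ acts on $\mathbb{P}^k(\mathbb{C})$ and hence on finite sets of points; for a finite set $T$ of points, $\mathrm{Aut}(T)=\{f\in \mathrm{PGL}_{k+1}(\mathbb{C}) : T^f=T\}$ (setwise stabilizer). A finite subgroup $H$ of $\mathrm{PGL}_{k+1}(\mathbb{C})$ is called admissible if there exists a finite set $T$ of $n\ge k+3$ distinct points of $\mathbb{P}^k(\mathbb{C})$ in general position such that $H\subseteq \mathrm{Aut}(T)$. Here $k=5$. *)

theory Defs
  imports
    "HOL-Analysis.Cartesian_Space"
    "HOL-Analysis.Determinants"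
    "HOL-Algebra.Elementary_Groups"
    "HOL-Number_Theory.Cong"
begin

text \<open>Throughout, \<open>CARD('n)\<close> plays the role of \<open>k + 1\<close>.  The constants prefixed by \<open>vec.\<close>
  are the linear-algebra notions over the scalar field \<open>complex\<close>; the unprefixed
  \<^const>\<open>span\<close> and \<^const>\<open>dim\<close> would be those over the reals.\<close>

definition proj_space :: "(complex ^ 'n) set set" where
  "proj_space = {vec.span {v} | v. v \<noteq> 0}"

text \<open>A projective subspace of dimension \<open>t - 1\<close> is a linear subspace of dimension \<open>t\<close>.\<close>

definition general_position :: "(complex ^ 'n) set set \<Rightarrow> bool" where
  "general_position T \<longleftrightarrow> T \<subseteq> proj_space \<and>
     (\<forall>S \<subseteq> T. finite S \<and> card S \<le> CARD('n) \<longrightarrow> vec.dim (vec.span (\<Union>S)) = card S)"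

definition GL :: "(complex ^ 'n ^ 'n) monoid" where
  "GL = \<lparr>carrier = {A. invertible A}, monoid.mult = (**), one = mat 1\<rparr>"

definition scalar_mats :: "(complex ^ 'n ^ 'n) set" where
  "scalar_mats = {mat c | c. c \<noteq> 0}"

definition PGL :: "(complex ^ 'n ^ 'n) set monoid" where
  "PGL = GL Mod scalar_mats"

lemma group_GL: "group (GL :: (complex ^ 'n ^ 'n) monoid)"
proof (rule groupI)
  fix A :: "complex ^ 'n ^ 'n" assume "A \<in> carrier GL"
  then show "\<exists>B \<in> carrier GL. B \<otimes>\<^bsub>GL\<^esub> A = \<one>\<^bsub>GL\<^esub>"
    by (auto simp: GL_def invertible_def)
next
  show "A \<otimes>\<^bsub>GL\<^esub> B \<in> carrier GL" if "A \<in> carrier GL" "B \<in> carrier GL"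
    for A B :: "complex ^ 'n ^ 'n"
    using that by (simp add: GL_def invertible_mult)
qed (auto simp: GL_def matrix_mul_assoc invertible_def)

lemma mat_mult_left: "mat c ** A = (\<chi> i j. c * A $ i $ j)"
  and mat_mult_right: "A ** mat c = (\<chi> i j. c * A $ i $ j)"
  for A :: "complex ^ 'n ^ 'n"
  by (simp_all add: matrix_matrix_mult_def mat_def vec_eq_iff if_distrib if_distribR
      sum.delta sum.delta' mult.commute cong: if_cong)

lemma mat_mult_mat: "mat c ** mat d = (mat (c * d) :: complex ^ 'n ^ 'n)"
  unfolding mat_mult_left by (simp add: vec_eq_iff mat_def)

lemma normal_scalar_mats: "scalar_mats \<lhd> (GL :: (complex ^ 'n ^ 'n) monoid)"
proof -
  interpret group "GL :: (complex ^ 'n ^ 'n) monoid" by (rule group_GL)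
  have mat_in: "mat c \<in> carrier (GL :: (complex ^ 'n ^ 'n) monoid)" if "c \<noteq> 0" for c
    using that by (auto simp: GL_def invertible_def mat_mult_mat intro!: exI[of _ "mat (inverse c)"])
  have "subgroup scalar_mats (GL :: (complex ^ 'n ^ 'n) monoid)"
  proof (rule subgroupI)
    show "scalar_mats \<subseteq> carrier (GL :: (complex ^ 'n ^ 'n) monoid)"
      using mat_in by (auto simp: scalar_mats_def)
    show "(scalar_mats :: (complex ^ 'n ^ 'n) set) \<noteq> {}"
      by (auto simp: scalar_mats_def intro: exI[of _ 1])
  next
    fix A :: "complex ^ 'n ^ 'n" assume "A \<in> scalar_mats"
    then obtain c where c: "c \<noteq> 0" "A = mat c" by (auto simp: scalar_mats_def)
    have "inv\<^bsub>GL\<^esub> A = mat (inverse c)"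
    proof (rule inv_equality)
      show "mat (inverse c) \<otimes>\<^bsub>GL\<^esub> A = \<one>\<^bsub>GL\<^esub>"
        using c by (simp add: GL_def mat_mult_mat)
    qed (use c mat_in in auto)
    with c show "inv\<^bsub>GL\<^esub> A \<in> scalar_mats" by (auto simp: scalar_mats_def)
    fix B :: "complex ^ 'n ^ 'n" assume "B \<in> scalar_mats"
    then obtain d where d: "d \<noteq> 0" "B = mat d" by (auto simp: scalar_mats_def)
    have "A \<otimes>\<^bsub>GL\<^esub> B = mat (c * d)" using c d by (simp add: GL_def mat_mult_mat)
    with c d show "A \<otimes>\<^bsub>GL\<^esub> B \<in> scalar_mats" by (auto simp: scalar_mats_def)
  qed
  then show ?thesis
    by (rule normalI) (auto simp: r_coset_def l_coset_def scalar_mats_def GL_def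
        mat_mult_left mat_mult_right)
qed

lemma group_PGL: "group (PGL :: (complex ^ 'n ^ 'n) set monoid)"
  unfolding PGL_def by (rule normal.factorgroup_is_group[OF normal_scalar_mats])

text \<open>An element of \<^const>\<open>PGL\<close> is a coset of matrices differing by nonzero scalars; since a point
  is closed under scaling, every representative \<open>A\<close> of \<open>f\<close> gives the same image \<open>(*v) A ` P\<close>.\<close>

definition pgl_act :: "(complex ^ 'n ^ 'n) set \<Rightarrow> (complex ^ 'n) set \<Rightarrow> (complex ^ 'n) set" where
  "pgl_act f P = {A *v v | A v. A \<in> f \<and> v \<in> P}"

lemma pgl_act_coset:
  "pgl_act (scalar_mats #>\<^bsub>GL\<^esub> A) (vec.span {v}) = vec.span {A *v v}"
proof -
  have *: "(mat c ** A) *v (k *s v) = (c * k) *s (A *v v)" for c k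
    unfolding mat_mult_left
    by (simp add: vec_eq_iff matrix_vector_mult_def sum_distrib_left mult_ac)
  have "pgl_act (scalar_mats #>\<^bsub>GL\<^esub> A) (vec.span {v})
      = {(mat c ** A) *v (k *s v) | c k. c \<noteq> 0}"
    unfolding pgl_act_def r_coset_def scalar_mats_def GL_def vec.span_singleton by auto
  also have "\<dots> = {(c * k) *s (A *v v) | c k. c \<noteq> 0}"
    by (simp only: *)
  also have "\<dots> = vec.span {A *v v}"
  proof (intro subset_antisym subsetI)
    fix x assume "x \<in> vec.span {A *v v}"
    then obtain k where "x = (1 * k) *s (A *v v)" by (auto simp: vec.span_singleton)
    then show "x \<in> {(c * k) *s (A *v v) | c k. c \<noteq> 0}" using one_neq_zero by blast
  qed (auto simp: vec.span_singleton)
  finally show ?thesis .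
qed

definition Aut_pts :: "(complex ^ 'n) set set \<Rightarrow> (complex ^ 'n ^ 'n) set set" where
  "Aut_pts T = {f \<in> carrier PGL. pgl_act f ` T = T}"

definition admissible :: "(complex ^ 'n ^ 'n) set set \<Rightarrow> bool" where
  "admissible H \<longleftrightarrow> subgroup H PGL \<and> finite H \<and>
     (\<exists>T. finite T \<and> card T \<ge> CARD('n) + 2 \<and> general_position T \<and> H \<subseteq> Aut_pts T)"

definition admissible_cyclic :: "nat \<Rightarrow> (complex ^ 'n ^ 'n) set set set" where
  "admissible_cyclic m = {H. admissible H \<and> cyclic_group (PGL\<lparr>carrier := H\<rparr>) \<and> card H = m}"

definition conj_rel :: "((complex ^ 'n ^ 'n) set set \<times> (complex ^ 'n ^ 'n) set set) set" where
  "conj_rel = {(H, K). subgroup H PGL \<and> subgroup K PGL \<and>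
     (\<exists>g \<in> carrier PGL. K = g <#\<^bsub>PGL\<^esub> H #>\<^bsub>PGL\<^esub> inv\<^bsub>PGL\<^esub> g)}"

end

theory Submission
  imports "HOL-Computational_Algebra.Polynomial" "HOL-Number_Theory.Residue_Primitive_Roots"
    "HOL-Algebra.Group_Action" Defs
begin

text \<open>
  Let \<open>n = 6\<close> and let \<open>H\<close> be a subgroup of order \<open>p > n\<close> preserving a set \<open>T\<close> of at least \<open>n + 2\<close>
  points in general position.  Over \<open>\<complex>\<close> a generator of \<open>H\<close> lifts to a matrix \<open>A\<close> with \<open>A\<^sup>p = 1\<close>.
  A matrix fixing \<open>n + 1\<close> points in general position is scalar (\<open>scalar_if_all_points_fixed\<close>), so \<open>A\<close>
  moves some point \<open>\<langle>v\<rangle>\<close> of \<open>T\<close>.  As \<open>p\<close> is prime, the orbit of \<open>\<langle>v\<rangle>\<close> consists of \<open>p\<close> points, and general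
  position makes \<open>v, A v, \<dots>, A\<^sup>n\<^sup>-\<^sup>1 v\<close> a basis.  Thus \<open>v\<close> is a cyclic vector, and \<open>A\<close> is conjugate to a
  diagonal matrix whose entries are \<open>n\<close> distinct \<open>p\<close>-th roots of unity \<open>z ^ a i\<close> (\<open>diagonalize\<close>).

  Conversely, every choice of distinct exponents \<open>a i\<close> gives an admissible group: take for \<open>T\<close> the
  orbit of the all-ones vector together with one coordinate point.  General position of this \<open>T\<close>
  says that certain minors of the Fourier matrix \<open>(z ^ (j * k))\<close> do not vanish, which is Chebotarev's
  theorem (\<open>chebotarev\<close>); it holds because \<open>p\<close> is prime.

  So a conjugacy class is recorded by an \<open>n\<close>-element set of exponents modulo \<open>p\<close>.  Multiplying \<open>A\<close> by a
  root of unity, which does not change its image in the projective group, translates this set;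
  passing to another generator of the group multiplies it by a unit; and nothing else is identified,
  because conjugate matrices have the same eigenvalues.  Hence the classes correspond to the orbits of
  the affine group of \<open>\<int>/p\<close> on \<open>n\<close>-element subsets (\<open>card_conj_classes_eq_card_affine_orbits\<close>).

  Burnside's lemma counts these orbits for \<open>n = 6\<close> (\<open>card_affine_orbits_six\<close>).  A nontrivial
  translation by \<open>t\<close> fixes no 6-element subset: comparing sums of elements would give \<open>p\<close> dividing \<open>6 t\<close>.  Any other
  nontrivial affine map is conjugate to \<open>s \<mapsto> u s\<close> with \<open>u \<noteq> 1\<close>; if \<open>u\<close> has order \<open>d\<close>, the nonzero
  residues split into \<open>(p - 1) / d\<close> cycles of length \<open>d\<close>, and a fixed 6-element subset is a union of
  \<open>6 / d\<close> cycles, or of \<open>{0}\<close> and \<open>5 / d\<close> cycles.  Only \<open>d = 2, 3, 5, 6\<close> contribute.  The order 2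
  always occurs, the orders 3 and 6 occur exactly if \<open>p \<equiv> 1\<close> modulo 3, and the order 5 exactly if
  \<open>p \<equiv> 1\<close> modulo 5, whence the four cases.
\<close>

section \<open>Chebotarev's theorem on minors of the Fourier matrix\<close>

locale prime_root_of_unity =
  fixes p :: nat and z :: complex
  assumes prime_p: "prime p" and z_pow_p: "z ^ p = 1" and z_ne_1: "z \<noteq> 1"
begin

lemma p_gt_1: "p > 1" using prime_p prime_gt_1_nat by blast

lemma z_ne_0 [simp]: "z \<noteq> 0"
  using z_pow_p p_gt_1 by (auto simp: power_0_left)

lemma z_pow_mod: "z ^ (k mod p) = z ^ k"
proof -
  have "z ^ k = z ^ (p * (k div p) + k mod p)" by simp
  also have "\<dots> = z ^ (k mod p)" unfolding power_add power_mult z_pow_p by simp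
  finally show ?thesis by simp
qed

lemma z_pow_eq_1_iff: "z ^ k = 1 \<longleftrightarrow> p dvd k"
proof
  assume k: "z ^ k = 1"
  show "p dvd k"
  proof (rule ccontr)
    assume "\<not> p dvd k"
    then have "coprime k p"
      using prime_p by (metis prime_imp_coprime coprime_commute)
    then obtain j where "[k * j = 1] (mod p)" using cong_solve_coprime_nat by (metis One_nat_def)
    then have "z ^ (k * j) = z ^ 1" by (metis z_pow_mod cong_def)
    then show False using k z_ne_1 by (simp add: power_mult)
  qed
qed (auto simp: power_mult z_pow_p elim!: dvdE)

lemma z_pow_eq_iff: "z ^ j = z ^ k \<longleftrightarrow> [j = k] (mod p)"
proof -
  have *: "[j = k] (mod p)" if "z ^ j = z ^ k" "j \<le> k" for j k
  proof -
    have "z ^ (k - j) * z ^ j = z ^ j" using that by (metis le_add_diff_inverse2 mult_1 power_add)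
    then have "p dvd k - j" by (simp add: z_pow_eq_1_iff)
    then show ?thesis using that(2) by (metis cong_altdef_nat cong_sym)
  qed
  have "z ^ j = z ^ k" if "[j = k] (mod p)" by (metis that z_pow_mod cong_def)
  then show ?thesis using *[of j k] *[of k j] by (metis cong_sym nat_le_linear)
qed

lemma inj_on_z_pow: "inj_on ((^) z) {..<p}"
  by (auto simp: inj_on_def z_pow_eq_iff cong_less_modulus_unique_nat)

lemma root_is_z_pow: assumes "w ^ p = 1" obtains k where "k < p" "w = z ^ k"
proof -
  have sub: "(^) z ` {..<p} \<subseteq> {w. w ^ p = 1}"
    by (auto simp: power_mult[symmetric] z_pow_eq_1_iff)
  have "card ((^) z ` {..<p}) = p" using card_image[OF inj_on_z_pow] by simp
  moreover have "card {w::complex. w ^ p = 1} = p"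
    using p_gt_1 by (intro card_roots_unity_eq) auto
  moreover have "finite {w::complex. w ^ p = 1}"
    using p_gt_1 by (intro finite_roots_unity) auto
  ultimately have "(^) z ` {..<p} = {w. w ^ p = 1}"
    using sub by (intro card_subset_eq) auto
  then show thesis using assms that by blast
qed

end

abbreviation int_eval :: "int poly \<Rightarrow> complex \<Rightarrow> complex" where
  "int_eval q w \<equiv> poly (map_poly of_int q) w"

lemma int_eval_pCons [simp]: "int_eval (pCons a q) w = of_int a + w * int_eval q w"
  by (simp add: map_poly_pCons)

lemma int_eval_add [simp]: "int_eval (q + r) w = int_eval q w + int_eval r w"
  by (induction q r rule: poly_induct2) (auto simp: algebra_simps)

lemma int_eval_smult [simp]: "int_eval (Polynomial.smult c q) w = of_int c * int_eval q w"
  by (induction q) (auto simp: algebra_simps)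

lemma int_eval_mult [simp]: "int_eval (q * r) w = int_eval q w * int_eval r w"
  by (induction q) (auto simp: algebra_simps)

lemma int_eval_minus [simp]: "int_eval (- q) w = - int_eval q w"
  using int_eval_smult[of "-1" q w] by simp

lemma int_eval_diff [simp]: "int_eval (q - r) w = int_eval q w - int_eval r w"
  using int_eval_add[of q "- r" w] by simp

lemma int_eval_1 [simp]: "int_eval 1 w = 1"
  by simp

lemma int_eval_monom [simp]: "int_eval (Polynomial.monom c n) w = of_int c * w ^ n"
  by (simp add: map_poly_monom poly_monom)

lemma int_eval_sum [simp]: "int_eval (\<Sum>i\<in>A. f i) w = (\<Sum>i\<in>A. int_eval (f i) w)"
  by (induction A rule: infinite_finite_induct) auto

lemma int_eval_prod [simp]: "int_eval (\<Prod>i\<in>A. f i) w = (\<Prod>i\<in>A. int_eval (f i) w)"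
  by (induction A rule: infinite_finite_induct) auto

lemma int_eval_pcompose [simp]: "int_eval (pcompose q r) w = int_eval q (int_eval r w)"
  by (induction q) (auto simp: pcompose_pCons)

context prime_root_of_unity
begin

text \<open>
  Reduction modulo the prime above \<open>p\<close> in \<open>\<int>[z]\<close>, expressed without that ring.  The product \<open>F\<close> of the
  polynomials \<open>q(x\<^sup>k)\<close>, \<open>0 < k < p\<close>, vanishes at every primitive \<open>p\<close>-th root of unity, since each of them
  has \<open>z\<close> among its powers.  So the monic \<open>\<Phi> = 1 + x + \<dots> + x\<^sup>p\<^sup>-\<^sup>1\<close> divides \<open>F\<close> over the integers,
  and evaluation at 1 gives \<open>p\<close> dividing \<open>q(1)\<^sup>p\<^sup>-\<^sup>1\<close>.
\<close>

lemma dvd_value_at_1: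
  fixes q :: "int poly"
  assumes "int_eval q z = 0"
  shows "int p dvd poly q 1"
proof -
  define \<Phi> :: "int poly" where "\<Phi> = (\<Sum>k<p. Polynomial.monom 1 k)"
  define F :: "int poly" where "F = (\<Prod>k\<in>{1..<p}. pcompose q (Polynomial.monom 1 k))"
  have coeff_\<Phi>: "Polynomial.coeff \<Phi> i = (if i < p then 1 else 0)" for i
    by (auto simp: \<Phi>_def coeff_sum coeff_monom)
  have deg_\<Phi>: "degree \<Phi> = p - 1"
    using p_gt_1 by (intro antisym degree_le le_degree) (auto simp: coeff_\<Phi>)
  have "\<Phi> \<noteq> 0" using coeff_\<Phi>[of 0] p_gt_1 by auto
  \<comment> \<open>\<open>\<Phi>\<close> is monic, so pseudo-division is division with remainder.\<close>
  obtain g r where gr: "pseudo_divmod F \<Phi> = (g, r)" by fastforce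
  have F: "F = \<Phi> * g + r" and r: "r = 0 \<or> degree r < p - 1"
    using pseudo_divmod[OF \<open>\<Phi> \<noteq> 0\<close> gr] p_gt_1 by (auto simp: deg_\<Phi> coeff_\<Phi>)
  have r_z: "int_eval r (z ^ j) = 0" if j: "j \<in> {1..<p}" for j
  proof -
    have "coprime j p"
      using j prime_p
      by (metis atLeastLessThan_iff coprime_commute nat_dvd_not_less prime_imp_coprime_nat
          zero_less_one order_less_le_trans)
    then obtain i where i: "[j * i = 1] (mod p)" using cong_solve_coprime_nat by (metis One_nat_def)
    have "i mod p \<noteq> 0"
    proof
      assume "i mod p = 0"
      then have "p dvd j * i" by auto
      then show False using i p_gt_1 by (metis cong_dvd_iff nat_dvd_1_iff_1 less_irrefl)
    qed
    then have i': "i mod p \<in> {1..<p}" using p_gt_1 by auto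
    have "(z ^ j) ^ (i mod p) = z ^ 1"
      unfolding power_mult[symmetric] z_pow_eq_iff using i by (metis cong_def mod_mult_right_eq)
    then have "int_eval (pcompose q (Polynomial.monom 1 (i mod p))) (z ^ j) = 0"
      using assms by simp
    then have "int_eval F (z ^ j) = 0"
      unfolding F_def int_eval_prod using i' by (intro prod_zero) auto
    moreover have "int_eval \<Phi> (z ^ j) = 0"
    proof -
      have "z ^ j \<noteq> 1" using j by (auto simp: z_pow_eq_1_iff dest: dvd_imp_le)
      moreover have "(z ^ j) ^ p = 1" by (simp add: power_mult[symmetric] z_pow_eq_1_iff)
      ultimately have "(\<Sum>k<p. (z ^ j) ^ k) = 0" by (simp add: sum_gp_strict)
      then show ?thesis by (simp add: \<Phi>_def)
    qed
    ultimately show ?thesis using arg_cong[OF F, of "\<lambda>q. int_eval q (z ^ j)"] by simp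
  qed
  have "r = 0"
  proof (rule ccontr)
    assume r0: "r \<noteq> 0"
    define R where "R = map_poly (of_int :: int \<Rightarrow> complex) r"
    have "R \<noteq> 0" using r0 by (simp add: R_def map_poly_eq_0_iff)
    have "p - 1 = card ((^) z ` {1..<p})"
      by (subst card_image) (auto intro: inj_on_subset[OF inj_on_z_pow])
    also have "\<dots> \<le> card {x. poly R x = 0}"
      using r_z \<open>R \<noteq> 0\<close> by (intro card_mono poly_roots_finite) (auto simp: R_def)
    also have "\<dots> \<le> degree R" using \<open>R \<noteq> 0\<close> by (rule card_poly_roots_bound)
    also have "\<dots> \<le> degree r" unfolding R_def by (rule map_poly_degree_leq)
    finally show False using r r0 by simp
  qed
  then have "poly F 1 = int p * poly g 1"
    unfolding F by (simp add: \<Phi>_def poly_sum poly_monom)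
  moreover have "poly F 1 = poly q 1 ^ (p - 1)"
    by (simp add: F_def poly_prod poly_pcompose poly_monom)
  ultimately have "int p dvd poly q 1 ^ (p - 1)" by (metis dvd_triv_left)
  then show ?thesis using prime_p prime_dvd_power by (metis prime_nat_int_transfer)
qed

text \<open>
  Setting \<open>x = 1\<close> and reducing modulo \<open>p\<close> makes the matrix \<open>M\<close> diagonal with invertible entries, so its
  determinant is not divisible by \<open>p\<close> there, and by \<open>dvd_value_at_1\<close> the determinant of \<open>M(z)\<close> is not 0.
  Gaussian elimination replaces the determinant: eliminating one variable preserves the shape of \<open>M\<close>.
\<close>

lemma diagonal_mod_imp_kernel_trivial:
  fixes M :: "'a \<Rightarrow> 'a \<Rightarrow> int poly" and c :: "'a \<Rightarrow> complex"
  assumes "finite I"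
    and "\<And>i l. i \<in> I \<Longrightarrow> l \<in> I \<Longrightarrow> int p dvd poly (M i l) 1 \<longleftrightarrow> i \<noteq> l"
    and "\<And>l. l \<in> I \<Longrightarrow> (\<Sum>i\<in>I. c i * int_eval (M i l) z) = 0"
    and "i \<in> I"
  shows "c i = 0"
  using assms
proof (induction I arbitrary: M i rule: finite_induct)
  case (insert n I)
  have p: "prime (int p)" using prime_p by simp
  have nz: "int_eval (M n n) z \<noteq> 0"
    using insert.prems(1)[of n n] dvd_value_at_1[of "M n n"] by auto
  have cn: "(\<Sum>i\<in>I. c i * int_eval (M i n) z) = - (c n * int_eval (M n n) z)"
    using insert.prems(2)[of n] insert.hyps by (simp add: eq_neg_iff_add_eq_0 add.commute)
  define M' where "M' i l = M n n * M i l - M i n * M n l" for i l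
  have *: "c i = 0" if "i \<in> I" for i
  proof (rule insert.IH[of M'])
    fix i l assume il: "i \<in> I" "l \<in> I"
    have "int p dvd poly (M i n) 1 * poly (M n l) 1"
      using insert.prems(1)[of i n] il insert.hyps by (intro dvd_mult2) auto
    then have "int p dvd poly (M' i l) 1 \<longleftrightarrow> int p dvd poly (M n n) 1 * poly (M i l) 1"
      unfolding M'_def poly_diff poly_mult by (metis diff_add_cancel dvd_add_left_iff)
    also have "\<dots> \<longleftrightarrow> int p dvd poly (M i l) 1"
      using insert.prems(1)[of n n] prime_dvd_mult_iff[OF p] by auto
    also have "\<dots> \<longleftrightarrow> i \<noteq> l" using insert.prems(1) il by auto
    finally show "int p dvd poly (M' i l) 1 \<longleftrightarrow> i \<noteq> l" .
  next
    fix l assume l: "l \<in> I"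
    have "(\<Sum>i\<in>I. c i * int_eval (M' i l) z)
        = int_eval (M n n) z * (\<Sum>i\<in>I. c i * int_eval (M i l) z)
          - int_eval (M n l) z * (\<Sum>i\<in>I. c i * int_eval (M i n) z)"
      by (simp add: M'_def algebra_simps sum_distrib_left sum_subtractf)
    also have "\<dots> = int_eval (M n n) z * (\<Sum>i\<in>insert n I. c i * int_eval (M i l) z)"
      unfolding cn using insert.hyps by (simp add: algebra_simps)
    also have "\<dots> = 0" using insert.prems(2)[of l] l by simp
    finally show "(\<Sum>i\<in>I. c i * int_eval (M' i l) z) = 0" .
  qed (use that in auto)
  then have "c n = 0" using cn nz by simp
  then show ?case using * insert.prems(3) by blast
qed auto

end

text \<open>
  The complete homogeneous symmetric polynomial of degree \<open>k - j\<close> in \<open>w 0, \<dots>, w j\<close>: the divided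
  difference of \<open>y\<^sup>k\<close> at the nodes \<open>w 0, \<dots>, w j\<close>.
\<close>

fun newton_coeff :: "(nat \<Rightarrow> 'a) \<Rightarrow> nat \<Rightarrow> nat \<Rightarrow> 'a :: comm_ring_1" where
  "newton_coeff w 0 j = (if j = 0 then 1 else 0)"
| "newton_coeff w (Suc k) 0 = w 0 * newton_coeff w k 0"
| "newton_coeff w (Suc k) (Suc j) = w (Suc j) * newton_coeff w k (Suc j) + newton_coeff w k j"

lemma newton_form:
  assumes "k < n"
  shows "y ^ k = (\<Sum>j<n. newton_coeff w k j * (\<Prod>i<j. y - w i))"
  using assms
proof (induction k arbitrary: n)
  case 0
  then have "{..<n} = insert 0 ({..<n} - {0})" by auto
  then show ?case by (subst \<open>{..<n} = _\<close>, subst sum.insert_remove) auto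
next
  case (Suc k)
  then obtain m where n: "n = Suc m" and "k < m" by (cases n) auto
  let ?N = "\<lambda>j. \<Prod>i<j. y - w i" and ?c = "newton_coeff w k"
  have zero: "newton_coeff w k j = 0" if "k < j" for k j
    using that
  proof (induction k arbitrary: j)
    case (Suc k) then show ?case by (cases j) auto
  qed auto
  have "y ^ Suc k = (\<Sum>j<m. ?c j * (y * ?N j))"
    using Suc.IH[OF \<open>k < m\<close>] by (simp add: sum_distrib_left mult_ac)
  also have "\<dots> = (\<Sum>j<m. ?c j * ?N (Suc j)) + (\<Sum>j<m. w j * ?c j * ?N j)"
    unfolding sum.distrib[symmetric] by (intro sum.cong) (simp_all add: algebra_simps)
  also have "(\<Sum>j<m. w j * ?c j * ?N j) = (\<Sum>j<Suc m. w j * ?c j * ?N j)"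
    using zero[OF \<open>k < m\<close>] by simp
  also have "\<dots> = w 0 * ?c 0 + (\<Sum>j<m. w (Suc j) * ?c (Suc j) * ?N (Suc j))"
    unfolding sum.lessThan_Suc_shift by simp
  also have "(\<Sum>j<m. ?c j * ?N (Suc j)) + \<dots>
      = w 0 * ?c 0 + (\<Sum>j<m. newton_coeff w (Suc k) (Suc j) * ?N (Suc j))"
    by (simp add: sum.distrib distrib_right mult.assoc)
  also have "\<dots> = (\<Sum>j<n. newton_coeff w (Suc k) j * ?N j)"
    unfolding n sum.lessThan_Suc_shift by simp
  finally show ?case .
qed

text \<open>
  If all nodes are 1, the Newton form is the expansion of \<open>y\<^sup>k\<close> in powers of \<open>y - 1\<close>.
\<close>

lemma newton_coeff_ones: "newton_coeff (\<lambda>_. 1) k j = of_nat (k choose j)"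
proof (induction k arbitrary: j)
  case 0 then show ?case by (cases j) auto
next
  case (Suc k) then show ?case by (cases j) auto
qed

lemma poly_newton_coeff: "poly (newton_coeff w k j) x = newton_coeff (\<lambda>i. poly (w i) x) k j"
  by (induction w k j rule: newton_coeff.induct) auto

lemma int_eval_newton_coeff:
  "int_eval (newton_coeff w k j) x = newton_coeff (\<lambda>i. int_eval (w i) x) k j"
  by (induction w k j rule: newton_coeff.induct) auto

text \<open>
  Multiplying \<open>k choose j\<close> by \<open>k - a\<close> gives an integral combination of \<open>k choose j\<close> and
  \<open>k choose (j + 1)\<close>.  With \<open>A = K - {l}\<close> the product separates \<open>l\<close> from the other elements of \<open>K\<close>, as
  in Lagrange interpolation.
\<close>

lemma prod_as_binomial_combination:
  assumes "finite A"
  shows "\<exists>b :: nat \<Rightarrow> int. \<forall>k. (\<Prod>i\<in>A. int k - int i) = (\<Sum>j\<le>card A. b j * int (k choose j))"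
  using assms
proof (induction A rule: finite_induct)
  case empty
  show ?case by (auto intro: exI[of _ "\<lambda>_. 1"])
next
  case (insert a A)
  then obtain b where b: "\<And>k. (\<Prod>i\<in>A. int k - int i) = (\<Sum>j\<le>card A. b j * int (k choose j))"
    by blast
  let ?n = "card A"
  define b' where "b' j = (if j = 0 then 0 else int j * b (j - 1))
    + (if j \<le> ?n then (int j - int a) * b j else 0)" for j
  have step: "(int k - int a) * int (k choose j)
      = int (Suc j) * int (k choose Suc j) + (int j - int a) * int (k choose j)" for k j
  proof -
    have "int k * int (k choose j) = int (Suc j) * int (k choose Suc j) + int j * int (k choose j)"
    proof (cases "j \<le> k")
      case True
      have "Suc j * (k choose Suc j) = (k - j) * (k choose j)"
        by (metis binomial_absorb_comp binomial_absorption)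
      then have "int (Suc j) * int (k choose Suc j) = (int k - int j) * int (k choose j)"
        using True by (metis of_nat_diff of_nat_mult)
      then show ?thesis by (simp add: algebra_simps)
    next
      case False
      then show ?thesis by (simp add: binomial_eq_0)
    qed
    then show ?thesis by (simp add: algebra_simps)
  qed
  have "(\<Prod>i\<in>insert a A. int k - int i) = (\<Sum>j\<le>card (insert a A). b' j * int (k choose j))" for k
  proof -
    have "(\<Prod>i\<in>insert a A. int k - int i)
        = (\<Sum>j\<le>?n. b j * ((int k - int a) * int (k choose j)))"
      using insert.hyps b by (simp add: sum_distrib_left mult_ac)
    also have "\<dots> = (\<Sum>j\<le>?n. int (Suc j) * b j * int (k choose Suc j))
        + (\<Sum>j\<le>?n. (int j - int a) * b j * int (k choose j))"
      unfolding step sum.distrib[symmetric] by (intro sum.cong) (simp_all add: algebra_simps)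
    also have "(\<Sum>j\<le>?n. int (Suc j) * b j * int (k choose Suc j))
        = (\<Sum>j\<le>Suc ?n. (if j = 0 then 0 else int j * b (j - 1)) * int (k choose j))"
      unfolding sum.atMost_Suc_shift by simp
    also have "(\<Sum>j\<le>?n. (int j - int a) * b j * int (k choose j))
        = (\<Sum>j\<le>Suc ?n. (if j \<le> ?n then (int j - int a) * b j else 0) * int (k choose j))"
      by simp
    finally show ?thesis
      using insert.hyps
      by (simp only: b'_def card_insert_disjoint[OF insert.hyps(1,2)] distrib_right sum.distrib)
  qed
  then show ?case by blast
qed

context prime_root_of_unity
begin

text \<open>
  This is Chebotarev's theorem that no minor of the Fourier matrix \<open>(z ^ (m * k))\<close> vanishes.

  Write the powers of \<open>y\<close> in Newton form at the roots \<open>w i = z ^ e i\<close>.  Vanishing at the nodes is a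
  triangular system, so all the coefficients \<open>C j\<close> of the combination are 0.  The matrix of this new
  system has entries that are integer polynomials in \<open>z\<close> and specialises to \<open>k choose j\<close> at 1, where all
  nodes coincide.  Recombining its columns by Lagrange interpolation makes it diagonal at 1 with entries
  prime to \<open>p\<close>, so only the zero solution remains.
\<close>

lemma chebotarev:
  assumes K: "K \<subseteq> {..<p}" and M: "M \<subseteq> {..<p}" and card: "card K \<le> card M"
    and vanish: "\<And>m. m \<in> M \<Longrightarrow> (\<Sum>k\<in>K. c k * z ^ (m * k)) = 0"
    and "k \<in> K"
  shows "c k = 0"
proof -
  have fin: "finite K" "finite M" using K M finite_subset by auto
  define n where "n = card K"
  obtain e where e: "bij_betw e {..<card M} M"
    using ex_bij_betw_nat_finite[OF fin(2)] by (auto simp: atLeast0LessThan)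
  define w where "w i = z ^ e i" for i
  have e_M: "e i \<in> M" if "i < n" for i
    using that card e by (auto simp: n_def bij_betw_def)
  have w_inj: "w i \<noteq> w j" if "i < j" "j < n" for i j
  proof
    assume "w i = w j"
    then have "e i = e j"
      using e_M[of i] e_M[of j] that M
      by (auto simp: w_def z_pow_eq_iff intro!: cong_less_modulus_unique_nat)
    moreover have "e i \<noteq> e j"
      using e that card inj_onD[of e "{..<card M}" i j] by (auto simp: n_def bij_betw_def)
    ultimately show False by simp
  qed
  define C where "C j = (\<Sum>k\<in>K. c k * newton_coeff w k j)" for j
  \<comment> \<open>Evaluate at the nodes in order: at the \<open>j\<close>-th node only the terms up to \<open>j\<close> survive.\<close>
  have C0: "C j = 0" if "j < n" for j
    using that
  proof (induction j rule: less_induct)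
    case (less j)
    let ?N = "\<lambda>i. \<Prod>h<i. w j - w h"
    have "n \<le> p" using card_mono[OF _ K] by (simp add: n_def)
    have "0 = (\<Sum>k\<in>K. c k * w j ^ k)"
      using vanish[OF e_M[OF less.prems]] by (simp add: w_def power_mult)
    also have "\<dots> = (\<Sum>k\<in>K. c k * (\<Sum>i<p. newton_coeff w k i * ?N i))"
      using K by (intro sum.cong refl arg_cong2[of _ _ _ _ "(*)"] newton_form) auto
    also have "\<dots> = (\<Sum>i<p. C i * ?N i)"
      unfolding C_def sum_distrib_left sum_distrib_right by (subst sum.swap) (simp add: mult_ac)
    also have "\<dots> = (\<Sum>i\<in>{j}. C i * ?N i)"
    proof (rule sum.mono_neutral_right)
      show "\<forall>i\<in>{..<p} - {j}. C i * ?N i = 0"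
      proof
        fix i assume i: "i \<in> {..<p} - {j}"
        show "C i * ?N i = 0"
        proof (cases "i < j")
          case True then show ?thesis using less by auto
        next
          case False
          then have "?N i = 0" using i by (intro prod_zero) auto
          then show ?thesis by simp
        qed
      qed
    qed (use less.prems \<open>n \<le> p\<close> in auto)
    finally have "C j * ?N j = 0" by simp
    moreover have "?N j \<noteq> 0" using w_inj[OF _ less.prems] by (simp add: prod_zero_iff) fastforce
    ultimately show ?case by simp
  qed
  have "\<exists>b. \<forall>l\<in>K. \<forall>k. (\<Prod>i\<in>K - {l}. int k - int i) = (\<Sum>j<n. b l j * int (k choose j))"
  proof (rule bchoice, rule ballI)
    fix l assume "l \<in> K"
    then have "{..card (K - {l})} = {..<n}"
      using fin by (auto simp: n_def card_Diff_singleton card_gt_0_iff) (metis Suc_pred card_gt_0_iff empty_iff less_Suc_eq_le)+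
    then show "\<exists>b. \<forall>k. (\<Prod>i\<in>K - {l}. int k - int i) = (\<Sum>j<n. b j * int (k choose j))"
      using prod_as_binomial_combination[of "K - {l}"] fin by auto
  qed
  then obtain b where b: "\<And>l k. l \<in> K \<Longrightarrow>
      (\<Prod>i\<in>K - {l}. int k - int i) = (\<Sum>j<n. b l j * int (k choose j))"
    by blast
  \<comment> \<open>At \<open>x = 1\<close> this is the Lagrange product over \<open>K - {l}\<close>, evaluated at \<open>k\<close>.\<close>
  define T where "T k l = (\<Sum>j<n. Polynomial.smult (b l j) (newton_coeff (\<lambda>i. Polynomial.monom 1 (e i)) k j))" for k l
  show "c k = 0"
  proof (rule diagonal_mod_imp_kernel_trivial[of K T c])
    fix k l assume kl: "k \<in> K" "l \<in> K"
    have "poly (T k l) 1 = (\<Prod>i\<in>K - {l}. int k - int i)"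
      by (simp add: T_def poly_sum poly_newton_coeff poly_monom newton_coeff_ones b kl)
    moreover have "int p dvd (\<Prod>i\<in>K - {l}. int k - int i) \<longleftrightarrow> k \<noteq> l"
    proof
      assume "int p dvd (\<Prod>i\<in>K - {l}. int k - int i)"
      then obtain i where i: "i \<in> K - {l}" "int p dvd int k - int i"
        using prime_p fin by (subst (asm) prime_dvd_prod_iff) auto
      then have "[k = i] (mod p)" by (simp add: cong_iff_dvd_diff cong_int_iff[symmetric])
      then show "k \<noteq> l" using i kl K cong_less_modulus_unique_nat by blast
    next
      assume "k \<noteq> l"
      then have "(\<Prod>i\<in>K - {l}. int k - int i) = 0" using kl fin by (intro prod_zero) auto
      then show "int p dvd (\<Prod>i\<in>K - {l}. int k - int i)" by simp
    qed
    ultimately show "int p dvd poly (T k l) 1 \<longleftrightarrow> k \<noteq> l" by simp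
  next
    fix l
    have "(\<Sum>k\<in>K. c k * int_eval (T k l) z) = (\<Sum>j<n. of_int (b l j) * C j)"
      unfolding T_def C_def w_def
      by (simp add: int_eval_newton_coeff sum_distrib_left mult_ac) (subst sum.swap, simp)
    then show "(\<Sum>k\<in>K. c k * int_eval (T k l) z) = 0" using C0 by simp
  qed (use fin \<open>k \<in> K\<close> in auto)
qed

end

section \<open>The affine group of residues and its action on subsets\<close>

definition affine_group :: "nat \<Rightarrow> (nat \<times> nat) monoid" where
  "affine_group p = \<lparr>carrier = {1..<p} \<times> {..<p},
     monoid.mult = (\<lambda>(u, t) (v, s). (u * v mod p, (u * s + t) mod p)), one = (1, 0)\<rparr>"

definition affine_map :: "nat \<Rightarrow> nat \<times> nat \<Rightarrow> nat \<Rightarrow> nat" where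
  "affine_map p = (\<lambda>(u, t) s. (u * s + t) mod p)"

lemma affine_map_mult:
  "affine_map p (g \<otimes>\<^bsub>affine_group p\<^esub> h) s = affine_map p g (affine_map p h s)"
proof -
  have "(u * v mod p * s + (u * t' + t) mod p) mod p = (u * ((v * s + t') mod p) + t) mod p" for u v t t'
  proof -
    have "[u * v mod p * s + (u * t' + t) mod p = u * v * s + (u * t' + t)] (mod p)"
      by (intro cong_add cong_mult cong_refl) (simp_all add: cong_def)
    also have "[u * v * s + (u * t' + t) = u * ((v * s + t') mod p) + t] (mod p)"
    proof -
      have "[u * (v * s + t') + t = u * ((v * s + t') mod p) + t] (mod p)"
        by (intro cong_add cong_mult cong_refl) (simp_all add: cong_def)
      then show ?thesis by (simp add: algebra_simps)
    qed
    finally show ?thesis by (simp add: cong_def)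
  qed
  then show ?thesis by (simp add: affine_group_def affine_map_def split_beta)
qed

lemma affine_map_cong_iff:
  fixes p u s t s' :: nat
  assumes "prime p" "\<not> p dvd u"
  shows "[u * s + t = u * s' + t] (mod p) \<longleftrightarrow> [s = s'] (mod p)"
proof -
  have "coprime u p" using prime_imp_coprime[OF assms] by (simp add: coprime_commute)
  then show ?thesis
    unfolding cong_add_rcancel_nat by (rule cong_mult_lcancel_nat)
qed

lemma not_dvd_if_less: "u \<in> {1..<p} \<Longrightarrow> \<not> p dvd (u::nat)"
  by (auto dest: dvd_imp_le)

lemma inj_on_affine_map:
  assumes "prime p" "g \<in> carrier (affine_group p)"
  shows "inj_on (affine_map p g) {..<p}"
proof (rule inj_onI)
  fix s s' assume s: "s \<in> {..<p}" "s' \<in> {..<p}" "affine_map p g s = affine_map p g s'"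
  obtain u t where g: "g = (u, t)" by (cases g)
  have "\<not> p dvd u" using assms(2) by (auto simp: g affine_group_def intro: not_dvd_if_less)
  then have "[s = s'] (mod p)"
    using s(3) affine_map_cong_iff[OF assms(1)] by (simp add: g affine_map_def cong_def)
  then show "s = s'" using s cong_less_modulus_unique_nat by blast
qed

lemma affine_group_group:
  assumes "prime p"
  shows "group (affine_group p)"
proof (rule groupI)
  have p: "p > 1" using assms prime_gt_1_nat by blast
  show "\<one>\<^bsub>affine_group p\<^esub> \<in> carrier (affine_group p)"
    using p by (simp add: affine_group_def)
  fix x assume x: "x \<in> carrier (affine_group p)"
  then obtain u t where ut: "x = (u, t)" "u \<in> {1..<p}" "t < p" by (auto simp: affine_group_def)
  show "\<one>\<^bsub>affine_group p\<^esub> \<otimes>\<^bsub>affine_group p\<^esub> x = x" using ut by (simp add: affine_group_def)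
  have mod_pos: "u * v mod p \<in> {1..<p}" if "\<not> p dvd u" "\<not> p dvd v" for u v
    using that assms p by (simp add: Suc_le_eq mod_greater_zero_iff_not_dvd prime_dvd_mult_iff)
  show "x \<otimes>\<^bsub>affine_group p\<^esub> y \<in> carrier (affine_group p)" if "y \<in> carrier (affine_group p)" for y
  proof -
    obtain v s where "y = (v, s)" "v \<in> {1..<p}" using \<open>y \<in> _\<close> by (auto simp: affine_group_def)
    then show ?thesis using ut p mod_pos[of u v] not_dvd_if_less by (simp add: affine_group_def)
  qed
  show "x \<otimes>\<^bsub>affine_group p\<^esub> y \<otimes>\<^bsub>affine_group p\<^esub> w
      = x \<otimes>\<^bsub>affine_group p\<^esub> (y \<otimes>\<^bsub>affine_group p\<^esub> w)" for y w
  proof -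
    obtain v s v' s' where yw: "y = (v, s)" "w = (v', s')" by (metis surj_pair)
    have "u * v mod p * v' mod p = u * (v * v' mod p) mod p"
      by (simp add: mod_mult_left_eq mod_mult_right_eq mult.assoc)
    moreover have "(u * v mod p * s' + (u * s + t) mod p) mod p = (u * ((v * s' + s) mod p) + t) mod p"
      using affine_map_mult[of p "(u, t)" "(v, s)" s'] by (simp add: affine_group_def affine_map_def)
    ultimately show ?thesis unfolding ut(1) yw by (simp add: affine_group_def)
  qed
  obtain v where v: "[u * v = 1] (mod p)"
    using assms ut(2) not_dvd_if_less by (metis One_nat_def cong_solve_coprime_nat coprime_commute prime_imp_coprime)
  then have v1: "u * v mod p = 1" using p by (simp add: cong_def)
  then have "\<not> p dvd v mod p" by (metis dvd_imp_mod_0 mod_mod_trivial mod_mult_right_eq mult_0_right mod_0 zero_neq_one)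
  then have "v mod p \<noteq> 0" by (metis dvd_0_right)
  then have "v mod p \<in> {1..<p}" using p by simp
  moreover have "(v mod p, (v mod p * (p - t)) mod p) \<otimes>\<^bsub>affine_group p\<^esub> x = \<one>\<^bsub>affine_group p\<^esub>"
  proof -
    have "v mod p * u mod p = 1" using v1 by (metis mod_mult_left_eq mult.commute)
    moreover have "(v mod p * t + v mod p * (p - t) mod p) mod p = (v mod p * (t + (p - t))) mod p"
      by (simp add: mod_add_right_eq distrib_left)
    ultimately show ?thesis using ut by (simp add: affine_group_def)
  qed
  ultimately show "\<exists>y\<in>carrier (affine_group p). y \<otimes>\<^bsub>affine_group p\<^esub> x = \<one>\<^bsub>affine_group p\<^esub>"
    using p by (intro bexI[of _ "(v mod p, (v mod p * (p - t)) mod p)"]) (auto simp: affine_group_def)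
qed

definition subsets_of_card :: "nat \<Rightarrow> nat \<Rightarrow> nat set set" where
  "subsets_of_card p m = {S. S \<subseteq> {..<p} \<and> card S = m}"

definition affine_action :: "nat \<Rightarrow> nat \<Rightarrow> nat \<times> nat \<Rightarrow> nat set \<Rightarrow> nat set" where
  "affine_action p m g = restrict (image (affine_map p g)) (subsets_of_card p m)"

lemma affine_image_in_subsets:
  assumes "prime p" "g \<in> carrier (affine_group p)" "S \<in> subsets_of_card p m"
  shows "affine_map p g ` S \<in> subsets_of_card p m"
proof -
  have "card (affine_map p g ` S) = card S"
    using assms inj_on_subset[OF inj_on_affine_map]
    by (intro card_image) (auto simp: subsets_of_card_def)
  moreover have "affine_map p g ` S \<subseteq> {..<p}"
    using assms(1) by (auto simp: affine_map_def split_beta prime_gt_0_nat)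
  ultimately show ?thesis using assms(3) by (simp add: subsets_of_card_def)
qed

lemma group_action_affine:
  assumes "prime p"
  shows "group_action (affine_group p) (subsets_of_card p m) (affine_action p m)"
proof -
  interpret A: group "affine_group p" by (rule affine_group_group[OF assms])
  let ?E = "subsets_of_card p m"
  have one: "affine_map p \<one>\<^bsub>affine_group p\<^esub> ` S = S" if "S \<in> ?E" for S
  proof -
    have "affine_map p \<one>\<^bsub>affine_group p\<^esub> ` S = (\<lambda>s. s) ` S"
      using that
      by (intro image_cong) (auto simp: subsets_of_card_def affine_map_def affine_group_def)
    then show ?thesis by simp
  qed
  have mult: "affine_map p (g \<otimes>\<^bsub>affine_group p\<^esub> h) ` S = affine_map p g ` affine_map p h ` S" for g h S
    by (simp add: image_image affine_map_mult)
  have bij: "affine_action p m g \<in> Bij ?E" if g: "g \<in> carrier (affine_group p)" for g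
  proof -
    have "bij_betw (image (affine_map p g)) ?E ?E"
    proof (rule bij_betwI[where g = "image (affine_map p (inv\<^bsub>affine_group p\<^esub> g))"])
      show "image (affine_map p g) \<in> ?E \<rightarrow> ?E"
        "image (affine_map p (inv\<^bsub>affine_group p\<^esub> g)) \<in> ?E \<rightarrow> ?E"
        using g affine_image_in_subsets[OF assms] by auto
    qed (simp_all only: mult[symmetric] A.l_inv[OF g] A.r_inv[OF g] one)
    then show ?thesis
      unfolding Bij_def affine_action_def by (simp cong: bij_betw_cong)
  qed
  have "affine_action p m \<in> hom (affine_group p) (BijGroup ?E)"
  proof (rule homI)
    fix g h assume gh: "g \<in> carrier (affine_group p)" "h \<in> carrier (affine_group p)"
    show "affine_action p m (g \<otimes>\<^bsub>affine_group p\<^esub> h)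
        = affine_action p m g \<otimes>\<^bsub>BijGroup ?E\<^esub> affine_action p m h"
    proof
      fix S
      show "affine_action p m (g \<otimes>\<^bsub>affine_group p\<^esub> h) S
          = (affine_action p m g \<otimes>\<^bsub>BijGroup ?E\<^esub> affine_action p m h) S"
        using bij[OF gh(1)] bij[OF gh(2)] affine_image_in_subsets[OF assms gh(2)]
        by (cases "S \<in> ?E") (simp_all add: BijGroup_def affine_action_def compose_def mult)
    qed
  qed (use bij in \<open>simp add: BijGroup_def\<close>)
  then show ?thesis
    unfolding group_action_def group_hom_def group_hom_axioms_def
    by (simp add: affine_group_group[OF assms] group_BijGroup)
qed

lemma in_affine_orbit_iff:
  assumes "S \<in> subsets_of_card p m"
  shows "T \<in> orbit (affine_group p) (affine_action p m) S
    \<longleftrightarrow> (\<exists>u\<in>{1..<p}. \<exists>t<p. T = (\<lambda>s. (u * s + t) mod p) ` S)"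
proof -
  have "T \<in> orbit (affine_group p) (affine_action p m) S
    \<longleftrightarrow> (\<exists>g\<in>carrier (affine_group p). T = affine_action p m g S)"
    unfolding orbit_def by blast
  also have "\<dots> \<longleftrightarrow> (\<exists>g\<in>{1..<p} \<times> {..<p}. T = affine_map p g ` S)"
    using assms by (simp add: affine_action_def affine_group_def)
  also have "\<dots> \<longleftrightarrow> (\<exists>u\<in>{1..<p}. \<exists>t\<in>{..<p}. T = affine_map p (u, t) ` S)"
    by (rule split_paired_Bex_Sigma)
  finally show ?thesis by (simp add: affine_map_def Bex_def)
qed

lemma invariants_affine:
  "invariants (subsets_of_card p m) (affine_action p m) (u, t)
    = {S \<in> subsets_of_card p m. (\<lambda>s. (u * s + t) mod p) ` S = S}"
  by (auto simp: invariants_def affine_action_def affine_map_def)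

text \<open>
  Translation by \<open>t\<close> adds \<open>m * t\<close> to the sum of the elements of a subset of size \<open>m\<close>, and \<open>p\<close> divides
  neither \<open>m\<close> nor \<open>t\<close>.
\<close>

lemma no_translation_invariant_subset:
  assumes p: "prime p" and t: "t \<in> {1..<p}" and m: "0 < m" "m < p"
  shows "invariants (subsets_of_card p m) (affine_action p m) (1, t) = {}"
proof -
  have False if S: "S \<in> subsets_of_card p m" and inv: "(\<lambda>s. (s + t) mod p) ` S = S" for S
  proof -
    have S': "S \<subseteq> {..<p}" "card S = m" using S by (auto simp: subsets_of_card_def)
    have "inj_on (\<lambda>s. (s + t) mod p) S"
      using S' inv m by (intro eq_card_imp_inj_on) (auto intro: finite_subset)
    then have "(\<Sum>s\<in>S. s) = (\<Sum>s\<in>S. (s + t) mod p)"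
      using sum.reindex[of "\<lambda>s. (s + t) mod p" S "\<lambda>s. s"] inv by simp
    then have "[(\<Sum>s\<in>S. s) = (\<Sum>s\<in>S. (s + t) mod p)] (mod p)" by (simp only: cong_refl)
    also have "[(\<Sum>s\<in>S. (s + t) mod p) = (\<Sum>s\<in>S. s + t)] (mod p)"
      by (intro cong_sum) (simp add: cong_def)
    also have "(\<Sum>s\<in>S. s + t) = (\<Sum>s\<in>S. s) + m * t" by (simp add: sum.distrib S')
    finally have "p dvd m * t" by (metis cong_add_lcancel_0_nat cong_sym cong_0_iff)
    then show False
      using p t m not_dvd_if_less[of t p] not_dvd_if_less[of m p] by (auto simp: prime_dvd_mult_iff)
  qed
  then show ?thesis by (auto simp: invariants_affine)
qed

text \<open>
  As \<open>u - 1\<close> is invertible modulo \<open>p\<close>, the map \<open>s \<mapsto> u s + t\<close> has a fixed point \<open>c\<close>; the translation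
  by \<open>c\<close> conjugates it to \<open>s \<mapsto> u s\<close>.
\<close>

lemma card_invariants_affine_conj:
  assumes p: "prime p" and u: "u \<in> {2..<p}" and t: "t < p"
  shows "card (invariants (subsets_of_card p m) (affine_action p m) (u, t))
       = card (invariants (subsets_of_card p m) (affine_action p m) (u, 0))"
proof -
  have "\<not> p dvd u - 1" using u by (intro not_dvd_if_less) auto
  then obtain w where w: "[(u - 1) * w = 1] (mod p)"
    using p by (metis One_nat_def cong_solve_coprime_nat coprime_commute prime_imp_coprime)
  define c where "c = (p - t) * w mod p"
  have c: "c < p" using t by (simp add: c_def)
  have fixed: "[u * c + t = c] (mod p)"
  proof -
    have "[(u - 1) * c = (u - 1) * ((p - t) * w)] (mod p)"
      by (intro cong_mult cong_refl) (simp add: c_def cong_def)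
    also have "(u - 1) * ((p - t) * w) = (p - t) * ((u - 1) * w)" by simp
    also have "[\<dots> = (p - t) * 1] (mod p)" using w by (intro cong_mult cong_refl)
    finally have "[(u - 1) * c + c + t = (p - t) * 1 + c + t] (mod p)"
      by (intro cong_add cong_refl)
    moreover have "(u - 1) * c + c + t = u * c + t" using u by (simp add: diff_mult_distrib)
    moreover have "(p - t) * 1 + c + t = c + p" using t by simp
    ultimately show ?thesis by (simp add: cong_def)
  qed
  let ?\<tau> = "\<lambda>s. (s + c) mod p" and ?\<sigma> = "\<lambda>s. (s + (p - c)) mod p"
  have \<tau>\<sigma>: "?\<tau> (?\<sigma> s) = s" "?\<sigma> (?\<tau> s) = s" if "s < p" for s
  proof -
    have "?\<tau> (?\<sigma> s) = (s + (p - c) + c) mod p" "?\<sigma> (?\<tau> s) = (s + c + (p - c)) mod p"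
      by (rule mod_add_left_eq)+
    moreover have "s + (p - c) + c = s + p" "s + c + (p - c) = s + p" using c by simp_all
    ultimately show "?\<tau> (?\<sigma> s) = s" "?\<sigma> (?\<tau> s) = s" using that by simp_all
  qed
  have conj: "(u * ?\<tau> s + t) mod p = ?\<tau> ((u * s) mod p)" for s
  proof -
    have "[u * ?\<tau> s + t = u * (s + c) + t] (mod p)"
      by (intro cong_add cong_mult cong_refl) (simp add: cong_def)
    also have "u * (s + c) + t = u * s + (u * c + t)" by (simp add: algebra_simps)
    also have "[\<dots> = (u * s) mod p + c] (mod p)"
      using fixed by (intro cong_add) (simp_all add: cong_def)
    finally show ?thesis by (simp add: cong_def)
  qed
  have conj': "(u * ?\<sigma> s) mod p = ?\<sigma> ((u * s + t) mod p)" if "s < p" for s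
    using conj[of "?\<sigma> s"] \<tau>\<sigma>[of s] \<tau>\<sigma>(2)[of "(u * ?\<sigma> s) mod p"] that by simp
  have mem: "?\<tau> ` S \<in> subsets_of_card p m" "?\<sigma> ` S \<in> subsets_of_card p m"
    if "S \<in> subsets_of_card p m" for S
  proof -
    have "(1, c) \<in> carrier (affine_group p)" "(1, (p - c) mod p) \<in> carrier (affine_group p)"
      using c prime_gt_1_nat[OF p] by (auto simp: affine_group_def)
    from affine_image_in_subsets[OF p this(1) that] affine_image_in_subsets[OF p this(2) that]
    show "?\<tau> ` S \<in> subsets_of_card p m" "?\<sigma> ` S \<in> subsets_of_card p m"
      by (simp_all add: affine_map_def mod_add_right_eq)
  qed
  have "bij_betw (image ?\<tau>)
      (invariants (subsets_of_card p m) (affine_action p m) (u, 0))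
      (invariants (subsets_of_card p m) (affine_action p m) (u, t))"
  proof (rule bij_betwI[where g = "image ?\<sigma>"]; (intro Pi_I)?)
    fix S assume "S \<in> invariants (subsets_of_card p m) (affine_action p m) (u, 0)"
    then have S: "S \<in> subsets_of_card p m" "(\<lambda>s. u * s mod p) ` S = S"
      by (auto simp: invariants_affine)
    have "(\<lambda>s. (u * s + t) mod p) ` ?\<tau> ` S = ?\<tau> ` (\<lambda>s. u * s mod p) ` S"
      unfolding image_image conj ..
    then show "?\<tau> ` S \<in> invariants (subsets_of_card p m) (affine_action p m) (u, t)"
      using mem S by (simp add: invariants_affine)
    have "?\<sigma> (?\<tau> s) = s" if "s \<in> S" for s
      using S \<tau>\<sigma>(2) that by (simp only: subsets_of_card_def) blast
    then have "?\<sigma> ` ?\<tau> ` S = (\<lambda>s. s) ` S"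
      unfolding image_image by (intro image_cong refl)
    then show "?\<sigma> ` ?\<tau> ` S = S" by simp
  next
    fix S assume "S \<in> invariants (subsets_of_card p m) (affine_action p m) (u, t)"
    then have S: "S \<in> subsets_of_card p m" "(\<lambda>s. (u * s + t) mod p) ` S = S"
      by (auto simp: invariants_affine)
    have "(\<lambda>s. u * s mod p) ` ?\<sigma> ` S = ?\<sigma> ` (\<lambda>s. (u * s + t) mod p) ` S"
      unfolding image_image using conj' S by (intro image_cong refl) (auto simp: subsets_of_card_def)
    then show "?\<sigma> ` S \<in> invariants (subsets_of_card p m) (affine_action p m) (u, 0)"
      using mem S by (simp add: invariants_affine)
    have "?\<tau> (?\<sigma> s) = s" if "s \<in> S" for s
      using S \<tau>\<sigma>(1) that by (simp only: subsets_of_card_def) blast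
    then have "?\<tau> ` ?\<sigma> ` S = (\<lambda>s. s) ` S"
      unfolding image_image by (intro image_cong refl)
    then show "?\<tau> ` ?\<sigma> ` S = S" by simp
  qed
  then show ?thesis using bij_betw_same_card by force
qed

lemma card_quotient_uniform:
  assumes "equiv A r" "finite A" and "\<And>C. C \<in> A // r \<Longrightarrow> card C = d"
  shows "d * card (A // r) = card A"
proof (subst Union_quotient[OF assms(1), symmetric], rule card_partition)
  show "finite (A // r)" "finite (\<Union> (A // r))"
    using assms by (auto simp: finite_quotient Union_quotient equiv_type)
  show "C \<inter> C' = {}" if "C \<in> A // r" "C' \<in> A // r" "C \<noteq> C'" for C C'
    using quotient_disj[OF assms(1) that(1,2)] that(3) by blast
qed (use assms in auto)

text \<open>
  A union of equivalence classes is determined by the set of classes it contains; if all classes have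
  size \<open>d\<close>, those of size \<open>m\<close> contain \<open>m / d\<close> of them.
\<close>

lemma card_saturated_subsets:
  assumes "equiv A r" "finite A" "d > 0" and d: "\<And>C. C \<in> A // r \<Longrightarrow> card C = d"
  shows "card {S. S \<subseteq> A \<and> r `` S \<subseteq> S \<and> card S = m}
       = (if d dvd m then (card A div d) choose (m div d) else 0)"
proof -
  let ?Q = "A // r"
  have finQ: "finite ?Q" using assms by (simp add: finite_quotient equiv_type)
  have card_U: "card (\<Union>B) = d * card B" if "B \<subseteq> ?Q" for B
  proof -
    have "finite (\<Union>B)" using that assms Union_quotient[OF assms(1)] by (metis Union_mono finite_subset)
    moreover have "C \<inter> D = {}" if "C \<in> B" "D \<in> B" "C \<noteq> D" for C D
      using that quotient_disj[OF assms(1), of C D] \<open>B \<subseteq> ?Q\<close> by blast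
    ultimately have "d * card B = card (\<Union>B)"
      using that d finQ by (intro card_partition) (auto intro: finite_subset)
    then show ?thesis by simp
  qed
  have inj: "inj_on Union (Pow ?Q)"
  proof (rule inj_onI)
    have *: "B = {C \<in> ?Q. C \<subseteq> \<Union>B}" if "B \<subseteq> ?Q" for B
    proof (intro Set.set_eqI iffI)
      fix C assume C: "C \<in> {C \<in> ?Q. C \<subseteq> \<Union>B}"
      then obtain x where "x \<in> C" using in_quotient_imp_non_empty[OF assms(1)] by blast
      then obtain D where "D \<in> B" "x \<in> D" using C by auto
      then have "C = D" using quotient_disj[OF assms(1), of C D] C \<open>x \<in> C\<close> that by blast
      then show "C \<in> B" using \<open>D \<in> B\<close> by simp
    qed (use that in auto)
    fix B B' assume "B \<in> Pow ?Q" "B' \<in> Pow ?Q" "\<Union>B = \<Union>B'"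
    then show "B = B'" using *[of B] *[of B'] by simp
  qed
  have sat: "{S. S \<subseteq> A \<and> r `` S \<subseteq> S} = Union ` Pow ?Q"
  proof (intro Set.set_eqI iffI)
    fix S assume "S \<in> {S. S \<subseteq> A \<and> r `` S \<subseteq> S}"
    then have S: "S \<subseteq> A" "r `` S \<subseteq> S" by auto
    have "S = \<Union>((\<lambda>x. r `` {x}) ` S)"
      using S equiv_class_self[OF assms(1)] by fast
    moreover have "(\<lambda>x. r `` {x}) ` S \<in> Pow ?Q" using S by (auto simp: quotient_def)
    ultimately show "S \<in> Union ` Pow ?Q" by blast
  next
    fix S assume "S \<in> Union ` Pow ?Q"
    then obtain B where B: "B \<subseteq> ?Q" "S = \<Union>B" by auto
    have "y \<in> S" if "x \<in> S" "(x, y) \<in> r" for x y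
      using that B in_quotient_imp_closed[OF assms(1)] by blast
    moreover have "S \<subseteq> A" using B Union_quotient[OF assms(1)] by auto
    ultimately show "S \<in> {S. S \<subseteq> A \<and> r `` S \<subseteq> S}" by auto
  qed
  have "{S. S \<subseteq> A \<and> r `` S \<subseteq> S \<and> card S = m}
      = {S \<in> {S. S \<subseteq> A \<and> r `` S \<subseteq> S}. card S = m}" by simp
  also have "\<dots> = Union ` {B. B \<subseteq> ?Q \<and> d * card B = m}"
    unfolding sat using card_U by auto
  finally have "card {S. S \<subseteq> A \<and> r `` S \<subseteq> S \<and> card S = m}
      = card (Union ` {B. B \<subseteq> ?Q \<and> d * card B = m})" by simp
  also have "\<dots> = card {B. B \<subseteq> ?Q \<and> d * card B = m}"
    by (intro card_image inj_on_subset[OF inj]) auto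
  also have "{B. B \<subseteq> ?Q \<and> d * card B = m}
      = (if d dvd m then {B. B \<subseteq> ?Q \<and> card B = m div d} else {})"
    using \<open>d > 0\<close> by auto
  also have "card ?Q = card A div d"
    using card_quotient_uniform[OF assms(1,2) d] \<open>d > 0\<close> by (metis nonzero_mult_div_cancel_left not_gr_zero)
  then have "card (if d dvd m then {B. B \<subseteq> ?Q \<and> card B = m div d} else {})
      = (if d dvd m then (card A div d) choose (m div d) else 0)"
    using n_subsets[OF finQ] by simp
  finally show ?thesis .
qed

definition mult_orbit_rel :: "nat \<Rightarrow> nat \<Rightarrow> (nat \<times> nat) set" where
  "mult_orbit_rel p u = {(s, s'). s \<in> {1..<p} \<and> s' \<in> {1..<p} \<and> (\<exists>k. s' = u ^ k * s mod p)}"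

text \<open>
  The classes are the cosets of the group generated by \<open>u\<close> in the group of nonzero residues.
\<close>

lemma mult_orbit_rel:
  assumes p: "prime p" and u: "u \<in> {1..<p}"
  shows equiv_mult_orbit_rel: "equiv {1..<p} (mult_orbit_rel p u)"
    and card_mult_orbit: "C \<in> {1..<p} // mult_orbit_rel p u \<Longrightarrow> card C = ord p u"
proof -
  have cop: "coprime p u" using prime_imp_coprime[OF p] not_dvd_if_less[OF u] by simp
  have u_ord: "[u ^ (ord p u * k) = 1] (mod p)" for k
    by (subst ord_divides) simp
  have mod_cancel: "u ^ k * (u ^ l * s mod p) mod p = u ^ (k + l) * s mod p" for k l s
    by (simp add: mod_mult_right_eq power_add mult.assoc)
  have closed: "u ^ k * s mod p \<in> {1..<p}" if "s \<in> {1..<p}" for k s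
  proof -
    have "\<not> p dvd u ^ k" using not_dvd_if_less[OF u] prime_dvd_power[OF p] by blast
    then have "\<not> p dvd u ^ k * s"
      using prime_dvd_multD[OF p] not_dvd_if_less[OF that] by blast
    then have "u ^ k * s mod p \<noteq> 0" by (simp only: dvd_eq_mod_eq_0 not_False_eq_True)
    then show ?thesis using prime_gt_0_nat[OF p] by simp
  qed
  show "equiv {1..<p} (mult_orbit_rel p u)"
  proof (rule equivI)
    show "mult_orbit_rel p u \<subseteq> {1..<p} \<times> {1..<p}" by (auto simp: mult_orbit_rel_def)
    show "refl_on {1..<p} (mult_orbit_rel p u)"
      by (auto simp: mult_orbit_rel_def intro!: refl_onI exI[of _ 0])
    show "trans (mult_orbit_rel p u)"
    proof (rule transI)
      fix x y w assume "(x, y) \<in> mult_orbit_rel p u" "(y, w) \<in> mult_orbit_rel p u"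
      then obtain k l where "x \<in> {1..<p}" "w \<in> {1..<p}" "y = u ^ k * x mod p" "w = u ^ l * y mod p"
        by (auto simp: mult_orbit_rel_def)
      then show "(x, w) \<in> mult_orbit_rel p u"
        by (simp add: mult_orbit_rel_def mod_cancel) (metis mod_cancel)
    qed
    show "sym (mult_orbit_rel p u)"
    proof (rule symI)
      fix x y assume "(x, y) \<in> mult_orbit_rel p u"
      then obtain k where x: "x \<in> {1..<p}" "y \<in> {1..<p}" "y = u ^ k * x mod p"
        by (auto simp: mult_orbit_rel_def)
      let ?l = "ord p u * k - k"
      have "?l + k = ord p u * k" using cop by (simp add: Suc_le_eq)
      then have "u ^ ?l * y mod p = u ^ (ord p u * k) * x mod p"
        unfolding x(3) mod_cancel by simp
      also have "\<dots> = 1 * x mod p"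
        using cong_mult[OF u_ord cong_refl] unfolding cong_def .
      also have "\<dots> = x" using x(1) by simp
      finally have "x = u ^ ?l * y mod p" by simp
      then show "(y, x) \<in> mult_orbit_rel p u" using x(1,2) unfolding mult_orbit_rel_def by blast
    qed
  qed
  assume "C \<in> {1..<p} // mult_orbit_rel p u"
  then obtain s where s: "s \<in> {1..<p}" "C = mult_orbit_rel p u `` {s}" by (auto elim: quotientE)
  have "C = (\<lambda>k. u ^ k * s mod p) ` {..<ord p u}"
  proof (intro subset_antisym subsetI)
    fix y assume "y \<in> C"
    then obtain k where k: "y = u ^ k * s mod p" using s by (auto simp: mult_orbit_rel_def)
    have "[u ^ (k mod ord p u) = u ^ k] (mod p)"
      unfolding order_divides_expdiff[OF cop] by (simp add: cong_def)
    then have "[u ^ (k mod ord p u) * s = u ^ k * s] (mod p)"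
      by (intro cong_mult cong_refl)
    then have "y = u ^ (k mod ord p u) * s mod p" using k by (simp add: cong_def)
    moreover have "k mod ord p u < ord p u" using cop by simp
    ultimately show "y \<in> (\<lambda>k. u ^ k * s mod p) ` {..<ord p u}" by blast
  next
    fix y assume "y \<in> (\<lambda>k. u ^ k * s mod p) ` {..<ord p u}"
    then show "y \<in> C" using s closed[OF s(1)] by (auto simp: mult_orbit_rel_def)
  qed
  moreover have "inj_on (\<lambda>k. u ^ k * s mod p) {..<ord p u}"
  proof (rule inj_onI)
    fix k l assume kl: "k \<in> {..<ord p u}" "l \<in> {..<ord p u}" "u ^ k * s mod p = u ^ l * s mod p"
    have "coprime s p"
      using prime_imp_coprime[OF p not_dvd_if_less[OF s(1)]] by (simp add: coprime_commute)
    then have "[u ^ k = u ^ l] (mod p)"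
      using kl(3) by (simp add: cong_mult_rcancel_nat flip: cong_def)
    then have "[k = l] (mod ord p u)" by (simp add: order_divides_expdiff[OF cop])
    then show "k = l" using kl cong_less_modulus_unique_nat by blast
  qed
  ultimately show "card C = ord p u" by (simp add: card_image)
qed

text \<open>
  A set stable under multiplication by \<open>u\<close> consists of full cycles of nonzero residues, possibly
  together with the fixed residue 0; the two summands count the sets without and with 0.
\<close>

lemma card_invariants_mult:
  assumes p: "prime p" and u: "u \<in> {1..<p}" and m: "m > 0"
  defines "d \<equiv> ord p u"
  shows "card (invariants (subsets_of_card p m) (affine_action p m) (u, 0))
    = (if d dvd m then ((p - 1) div d) choose (m div d) else 0)
    + (if d dvd m - 1 then ((p - 1) div d) choose ((m - 1) div d) else 0)"
proof -
  let ?A = "{1..<p}" and ?r = "mult_orbit_rel p u" and ?f = "\<lambda>s. u * s mod p"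
  note eq = equiv_mult_orbit_rel[OF p u]
  have p0: "p > 1" using p prime_gt_1_nat by blast
  have "coprime p u" using prime_imp_coprime[OF p] not_dvd_if_less[OF u] by simp
  then have d0: "d > 0" by (simp add: d_def)
  have f_closed: "?f s \<in> ?A" if "s \<in> ?A" for s
  proof -
    have "\<not> p dvd u * s"
      using prime_dvd_multD[OF p] not_dvd_if_less[OF that] not_dvd_if_less[OF u] by blast
    then have "u * s mod p \<noteq> 0" by (simp only: dvd_eq_mod_eq_0 not_False_eq_True)
    then show ?thesis using p0 by simp
  qed
  have r_f: "(s, ?f s) \<in> ?r" if "s \<in> ?A" for s
    using that f_closed[OF that] by (auto simp: mult_orbit_rel_def intro!: exI[of _ 1])
  have inj: "inj_on ?f {..<p}"
    using inj_on_affine_map[OF p, of "(u, 0)"] u by (simp add: affine_group_def affine_map_def)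
  have sat_iff: "?f ` S = S \<longleftrightarrow> ?r `` S \<subseteq> S" if S: "S \<subseteq> ?A" for S
  proof
    assume f: "?f ` S = S"
    have "u ^ k * s mod p \<in> S" if "s \<in> S" for k s
    proof (induction k)
      case 0 then show ?case using that S by auto
    next
      case (Suc k)
      have "u ^ Suc k * s mod p = ?f (u ^ k * s mod p)" by (simp add: mod_mult_right_eq mult.assoc)
      then show ?case using Suc f by blast
    qed
    then show "?r `` S \<subseteq> S" by (auto simp: mult_orbit_rel_def)
  next
    assume r: "?r `` S \<subseteq> S"
    have "?f ` S \<subseteq> S" using r r_f S by blast
    moreover have "card (?f ` S) = card S"
      using S by (intro card_image inj_on_subset[OF inj]) auto
    ultimately show "?f ` S = S" using S by (metis card_subset_eq finite_atLeastLessThan finite_subset)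
  qed
  define F where "F n = {S. S \<subseteq> ?A \<and> ?r `` S \<subseteq> S \<and> card S = n}" for n
  have F_fin: "finite (F n)" for n by (simp add: F_def)
  have card_F: "card (F n) = (if d dvd n then ((p - 1) div d) choose (n div d) else 0)" for n
    unfolding F_def
    using card_saturated_subsets[OF eq _ d0, of n] card_mult_orbit[OF p u] by (simp add: d_def)
  have "invariants (subsets_of_card p m) (affine_action p m) (u, 0) = F m \<union> insert 0 ` F (m - 1)"
  proof (intro subset_antisym subsetI)
    fix S assume "S \<in> invariants (subsets_of_card p m) (affine_action p m) (u, 0)"
    then have S: "S \<subseteq> {..<p}" "card S = m" "?f ` S = S"
      unfolding invariants_affine by (auto simp: subsets_of_card_def)
    show "S \<in> F m \<union> insert 0 ` F (m - 1)"
    proof (cases "0 \<in> S")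
      case False
      then have "S \<subseteq> ?A" using S(1) by (auto simp: Suc_le_eq intro!: Nat.gr0I)
      then have "S \<in> F m" using S sat_iff by (simp add: F_def)
      then show ?thesis by simp
    next
      case True
      define S' where "S' = S - {0}"
      have S': "S' \<subseteq> ?A" "S = insert 0 S'" using S(1) True by (auto simp: S'_def Suc_le_eq)
      have "?f ` S' \<subseteq> S'"
      proof (rule image_subsetI)
        fix s assume s: "s \<in> S'"
        then have "?f s \<in> S" using S(3) S'(2) by blast
        moreover have "?f s \<noteq> 0" using f_closed[of s] s S'(1) by fastforce
        ultimately show "?f s \<in> S'" by (simp add: S'_def)
      qed
      moreover have "card (?f ` S') = card S'"
        using S' by (intro card_image inj_on_subset[OF inj]) auto
      ultimately have "?f ` S' = S'" using S' by (metis card_subset_eq finite_atLeastLessThan finite_subset)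
      moreover have "card S' = m - 1" using S True by (simp add: S'_def)
      ultimately have "S' \<in> F (m - 1)" using S' sat_iff by (simp add: F_def)
      then show ?thesis using S' by blast
    qed
  next
    fix S assume "S \<in> F m \<union> insert 0 ` F (m - 1)"
    then consider "S \<in> F m" | S' where "S' \<in> F (m - 1)" "S = insert 0 S'" by blast
    then show "S \<in> invariants (subsets_of_card p m) (affine_action p m) (u, 0)"
    proof cases
      case 1
      then have S: "S \<subseteq> ?A" "card S = m" "?f ` S = S" using sat_iff by (auto simp: F_def)
      then have "S \<subseteq> {..<p}" by auto
      with S show ?thesis unfolding invariants_affine by (simp add: subsets_of_card_def)
    next
      case 2
      then have S: "S' \<subseteq> ?A" "card S' = m - 1" "?f ` S' = S'" using sat_iff by (auto simp: F_def)
      have "finite S'" using S(1) by (rule finite_subset) simp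
      moreover have "0 \<notin> S'" using S(1) by auto
      ultimately have "card S = m" using 2 S m by simp
      moreover have "S \<subseteq> {..<p}" using S p0 2 by auto
      ultimately show ?thesis using S 2 unfolding invariants_affine by (simp add: subsets_of_card_def)
    qed
  qed
  moreover have "card (insert 0 ` F (m - 1)) = card (F (m - 1))"
  proof (rule card_image, rule inj_onI)
    fix S S' assume "S \<in> F (m - 1)" "S' \<in> F (m - 1)" "insert 0 S = insert 0 S'"
    moreover from this have "0 \<notin> S" "0 \<notin> S'" by (auto simp: F_def)
    ultimately show "S = S'" by (simp add: insert_ident)
  qed
  moreover have "F m \<inter> insert 0 ` F (m - 1) = {}" by (auto simp: F_def)
  ultimately show ?thesis using card_F F_fin by (simp add: card_Un_disjoint)
qed

text \<open>
  In Burnside's sum the identity fixes all subsets, the other translations none, and for \<open>u \<noteq> 1\<close> each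
  of the \<open>p\<close> maps with linear part \<open>u\<close> fixes as many as multiplication by \<open>u\<close>.
\<close>

lemma burnside_affine:
  assumes p: "prime p" and m: "0 < m" "m < p"
  shows "card (orbits (affine_group p) (subsets_of_card p m) (affine_action p m)) * (p * (p - 1))
    = (p choose m) +
      p * (\<Sum>u\<in>{2..<p}. card (invariants (subsets_of_card p m) (affine_action p m) (u, 0)))"
proof -
  interpret group_action "affine_group p" "subsets_of_card p m" "affine_action p m"
    by (rule group_action_affine[OF p])
  let ?E = "subsets_of_card p m" and ?\<phi> = "affine_action p m"
  let ?I = "\<lambda>g. card (invariants ?E ?\<phi> g)"
  have p1: "p > 1" using p prime_gt_1_nat by blast
  have carrier: "carrier (affine_group p) = {1..<p} \<times> {..<p}" by (simp add: affine_group_def)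
  have order: "order (affine_group p) = p * (p - 1)" by (simp add: order_def carrier)
  have "finite ?E" by (rule finite_subset[of _ "Pow {..<p}"]) (auto simp: subsets_of_card_def)
  then have "card (orbits (affine_group p) ?E ?\<phi>) * (p * (p - 1))
      = (\<Sum>g\<in>{1..<p} \<times> {..<p}. ?I g)"
    using burnside by (simp add: order carrier)
  also have "\<dots> = (\<Sum>u\<in>{1..<p}. \<Sum>t<p. ?I (u, t))" by (simp add: sum.cartesian_product)
  also have "{1..<p} = insert 1 {2..<p}" using p1 by auto
  also have "(\<Sum>u\<in>insert 1 {2..<p}. \<Sum>t<p. ?I (u, t))
      = (\<Sum>t<p. ?I (1, t)) + (\<Sum>u\<in>{2..<p}. \<Sum>t<p. ?I (u, t))" by simp
  also have "(\<Sum>u\<in>{2..<p}. \<Sum>t<p. ?I (u, t)) = p * (\<Sum>u\<in>{2..<p}. ?I (u, 0))"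
  proof -
    have "(\<Sum>t<p. ?I (u, t)) = (\<Sum>t<p. ?I (u, 0))" if "u \<in> {2..<p}" for u
      using that by (intro sum.cong refl card_invariants_affine_conj[OF p]) auto
    then show ?thesis by (simp add: sum_distrib_left)
  qed
  also have "(\<Sum>t<p. ?I (1, t)) = (\<Sum>t\<in>{0}. ?I (1, t))"
    using no_translation_invariant_subset[OF p _ m] p1
    by (intro sum.mono_neutral_right) auto
  also have "\<dots> = (p choose m)"
  proof -
    have "(\<lambda>s. s mod p) ` S = S" if "S \<subseteq> {..<p}" for S
    proof -
      have "(\<lambda>s. s mod p) ` S = (\<lambda>s. s) ` S" using that by (intro image_cong) auto
      then show ?thesis by simp
    qed
    then have "invariants ?E ?\<phi> (1, 0) = {S. S \<subseteq> {..<p} \<and> card S = m}"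
      unfolding invariants_affine unfolding subsets_of_card_def
      by (intro Collect_cong) (simp cong: conj_cong)
    then show ?thesis by (simp add: n_subsets)
  qed
  finally show ?thesis .
qed


section \<open>The number of affine orbits\<close>

lemma real_choose:
  "real (n choose 2) = real n * (real n - 1) / 2"
  "real (n choose 3) = real n * (real n - 1) * (real n - 2) / 6"
  "real (n choose 6) = real n * (real n - 1) * (real n - 2) * (real n - 3) * (real n - 4) * (real n - 5) / 720"
  by (simp_all add: binomial_gbinomial gbinomial_prod_rev numeral_eq_Suc)

text \<open>
  The multiplicative group modulo \<open>p\<close> is cyclic, so it has \<open>totient d\<close> elements of each order \<open>d\<close>
  dividing \<open>p - 1\<close>.
\<close>

lemma sum_over_orders:
  fixes f :: "nat \<Rightarrow> nat"
  assumes p: "prime p" and D: "finite D" "1 \<notin> D" and f: "\<And>d. d \<noteq> 1 \<Longrightarrow> d \<notin> D \<Longrightarrow> f d = 0"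
  shows "(\<Sum>u\<in>{2..<p}. f (ord p u)) = (\<Sum>d\<in>D. (if d dvd p - 1 then totient d else 0) * f d)"
proof -
  have p1: "p > 1" using p prime_gt_1_nat by blast
  have ord1: "ord p u = 1 \<longleftrightarrow> u = 1" if "u \<in> {1..<p}" for u
    using that p1 by (simp add: ord_eq_Suc_0_iff cong_def)
  have "(\<Sum>u\<in>{2..<p}. f (ord p u)) = (\<Sum>u\<in>{2..<p}. \<Sum>d\<in>D. if ord p u = d then f d else 0)"
  proof (intro sum.cong refl)
    fix u assume u: "u \<in> {2..<p}"
    then have "ord p u \<noteq> 1" using ord1[of u] by auto
    then show "f (ord p u) = (\<Sum>d\<in>D. if ord p u = d then f d else 0)"
      using f[of "ord p u"] D by (simp add: sum.delta')
  qed
  also have "\<dots> = (\<Sum>d\<in>D. \<Sum>u\<in>{2..<p}. if ord p u = d then f d else 0)"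
    by (rule sum.swap)
  also have "\<dots> = (\<Sum>d\<in>D. (if d dvd p - 1 then totient d else 0) * f d)"
  proof (intro sum.cong refl)
    fix d assume "d \<in> D"
    then have d1: "d \<noteq> 1" using D by auto
    have "(\<Sum>u\<in>{2..<p}. if ord p u = d then f d else 0) = card {u \<in> {2..<p}. ord p u = d} * f d"
      by (simp add: sum.If_cases Int_def)
    also have "{u \<in> {2..<p}. ord p u = d} = {u \<in> totatives p. ord p u = d}"
    proof (intro Set.set_eqI iffI)
      fix u assume "u \<in> {u \<in> totatives p. ord p u = d}"
      then have "u \<in> {1..<p}" "ord p u = d" using p by (auto simp: totatives_prime)
      moreover from this have "u \<noteq> 1" using ord1[of u] d1 by auto
      ultimately show "u \<in> {u \<in> {2..<p}. ord p u = d}" by auto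
    qed (use p in \<open>auto simp: totatives_prime\<close>)
    also have "card \<dots> = (if d dvd p - 1 then totient d else 0)"
      using p1 by (intro prime_card_elements_with_ord_eq_totient[OF _ p]) auto
    finally show "(\<Sum>u\<in>{2..<p}. if ord p u = d then f d else 0)
        = (if d dvd p - 1 then totient d else 0) * f d" .
  qed
  finally show ?thesis .
qed

lemma card_affine_orbits_six:
  assumes p: "prime p" "p \<ge> 7"
  defines "x \<equiv> real p"
  shows "real (card (orbits (affine_group p) (subsets_of_card p 6) (affine_action p 6)))
    = (x - 2) * (x - 3) * (x - 4) * (x - 5) / 720 + (x - 3) * (x - 5) / 48
      + (if [p = 1] (mod 3) then (x - 4) / 9 + 1 / 3 else 0)
      + (if [p = 1] (mod 5) then 4 / 5 else 0)"
proof -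
  define N where "N = card (orbits (affine_group p) (subsets_of_card p 6) (affine_action p 6))"
  define f where "f d = (if d dvd 6 then ((p - 1) div d) choose (6 div d) else 0)
    + (if d dvd 5 then ((p - 1) div d) choose (5 div d) else 0)" for d :: nat
  have dvd6: "d \<in> {1, 2, 3, 6}" if "d dvd 6" for d :: nat
  proof -
    have "d \<le> 6" using that by (rule dvd_imp_le) simp
    then have "d \<in> {0, 1, 2, 3, 4, 5, 6}" by auto
    then show ?thesis using that by auto
  qed
  have dvd5: "d \<in> {1, 5}" if "d dvd 5" for d :: nat
  proof -
    have "d \<le> 5" using that by (rule dvd_imp_le) simp
    then have "d \<in> {0, 1, 2, 3, 4, 5}" by auto
    then show ?thesis using that by auto
  qed
  have "odd p" using p prime_odd_nat by auto
  have dvd_iff: "d dvd p - 1 \<longleftrightarrow> [p = 1] (mod d)" for d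
    using p(2) cong_altdef_nat[of 1 p d] by (simp add: cong_sym_eq)
  have six: "6 dvd p - 1 \<longleftrightarrow> [p = 1] (mod 3)"
  proof -
    have "2 dvd p - 1" using \<open>odd p\<close> by simp
    then have "6 dvd p - 1 \<longleftrightarrow> 3 dvd p - 1" by presburger
    then show ?thesis unfolding dvd_iff[of 3] .
  qed
  have tot: "totient 2 = 1" "totient 3 = 2" "totient 5 = 4" "totient 6 = 2"
  proof -
    show "totient 2 = 1" "totient 3 = 2" "totient 5 = 4" by (simp_all add: totient_prime)
    then show "totient 6 = 2" using totient_mult_coprime[of 2 3] by simp
  qed
  have "N * (p * (p - 1)) = (p choose 6)
      + p * (\<Sum>u\<in>{2..<p}. card (invariants (subsets_of_card p 6) (affine_action p 6) (u, 0)))"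
    unfolding N_def using p by (intro burnside_affine) auto
  also have "(\<Sum>u\<in>{2..<p}. card (invariants (subsets_of_card p 6) (affine_action p 6) (u, 0)))
      = (\<Sum>u\<in>{2..<p}. f (ord p u))"
  proof (intro sum.cong refl)
    fix u assume "u \<in> {2..<p}"
    then show "card (invariants (subsets_of_card p 6) (affine_action p 6) (u, 0)) = f (ord p u)"
      using card_invariants_mult[OF p(1), of u 6] by (simp add: f_def)
  qed
  also have "\<dots> = (\<Sum>d\<in>{2, 3, 5, 6}. (if d dvd p - 1 then totient d else 0) * f d)"
  proof (rule sum_over_orders[OF p(1)])
    fix d :: nat assume "d \<noteq> 1" "d \<notin> {2, 3, 5, 6}"
    then show "f d = 0" using dvd6[of d] dvd5[of d] by (auto simp: f_def)
  qed auto
  finally have N: "N * (p * (p - 1)) = (p choose 6)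
      + p * (\<Sum>d\<in>{2, 3, 5, 6}. (if d dvd p - 1 then totient d else 0) * f d)" .
  have f2: "f 2 = ((p - 1) div 2) choose 3" and f3: "f 3 = ((p - 1) div 3) choose 2"
    and f5: "f 5 = (p - 1) div 5" and f6: "f 6 = (p - 1) div 6"
    by (simp_all add: f_def)
  have quot: "real ((p - 1) div d) = (x - 1) / real d" if "d dvd p - 1" for d
    using that p(2) by (simp add: real_of_nat_div x_def of_nat_diff)
  have x: "x \<ge> 7" using p(2) by (simp add: x_def)
  have t2: "real ((if 2 dvd p - 1 then totient 2 else 0) * f 2) = (x - 1) * (x - 3) * (x - 5) / 48"
  proof -
    have two: "2 dvd p - 1" using \<open>odd p\<close> by simp
    then have "real ((if 2 dvd p - 1 then totient 2 else 0) * f 2) = real (((p - 1) div 2) choose 3)"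
      unfolding f2 tot by (simp only: if_True mult_1)
    also have "\<dots> = (x - 1) * (x - 3) * (x - 5) / 48"
      unfolding real_choose quot[OF two] by (simp add: field_simps)
    finally show ?thesis .
  qed
  have t3: "real ((if 3 dvd p - 1 then totient 3 else 0) * f 3)
      = (if [p = 1] (mod 3) then (x - 1) * (x - 4) / 9 else 0)"
  proof (cases "3 dvd p - 1")
    case True
    then have "real ((if 3 dvd p - 1 then totient 3 else 0) * f 3) = 2 * real (((p - 1) div 3) choose 2)"
      unfolding f3 tot by (simp only: if_True of_nat_mult of_nat_numeral)
    also have "\<dots> = (x - 1) * (x - 4) / 9"
      unfolding real_choose quot[OF True] by (simp add: field_simps)
    finally show ?thesis using True dvd_iff[of 3] by (simp only: if_True)
  qed (simp add: dvd_iff[of 3, simplified])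
  have t5: "real ((if 5 dvd p - 1 then totient 5 else 0) * f 5)
      = (if [p = 1] (mod 5) then 4 * (x - 1) / 5 else 0)"
    unfolding f5 tot using quot[of 5] dvd_iff[of 5] by (cases "5 dvd p - 1") simp_all
  have t6: "real ((if 6 dvd p - 1 then totient 6 else 0) * f 6)
      = (if [p = 1] (mod 3) then (x - 1) / 3 else 0)"
    unfolding f6 tot using quot[of 6] six by (cases "6 dvd p - 1") simp_all
  have sum4: "(\<Sum>d\<in>{2, 3, 5, 6::nat}. g d) = g 2 + (g 3 + (g 5 + g 6))" for g :: "nat \<Rightarrow> real"
    by simp
  have "real N * (x * (x - 1)) = real (N * (p * (p - 1)))"
    using p(2) by (simp add: x_def of_nat_diff)
  also have "\<dots> = x * (x - 1) * (x - 2) * (x - 3) * (x - 4) * (x - 5) / 720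
      + x * ((x - 1) * (x - 3) * (x - 5) / 48
        + ((if [p = 1] (mod 3) then (x - 1) * (x - 4) / 9 else 0)
        + ((if [p = 1] (mod 5) then 4 * (x - 1) / 5 else 0)
        + (if [p = 1] (mod 3) then (x - 1) / 3 else 0))))"
    unfolding N of_nat_add of_nat_mult[of p] of_nat_sum sum4 t2 t3 t5 t6 real_choose x_def ..
  also have "\<dots> = ((x - 2) * (x - 3) * (x - 4) * (x - 5) / 720 + (x - 3) * (x - 5) / 48
      + (if [p = 1] (mod 3) then (x - 4) / 9 + 1 / 3 else 0)
      + (if [p = 1] (mod 5) then 4 / 5 else 0)) * (x * (x - 1))"
    by (simp add: field_simps)
  finally show ?thesis using x by (simp add: N_def)
qed

section \<open>The projective linear group in terms of matrices\<close>

definition pgl_class :: "complex ^ 'n ^ 'n \<Rightarrow> (complex ^ 'n ^ 'n) set" where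
  "pgl_class A = scalar_mats #>\<^bsub>GL\<^esub> A"

lemma in_pgl_class_iff: "B \<in> pgl_class A \<longleftrightarrow> (\<exists>c. c \<noteq> 0 \<and> B = mat c ** A)"
  by (auto simp: pgl_class_def r_coset_def scalar_mats_def GL_def)

lemma mat_commute: "A ** mat c = mat c ** (A :: complex ^ 'n ^ 'n)"
  by (simp add: mat_mult_left mat_mult_right)

lemma self_in_pgl_class: "A \<in> pgl_class A"
  unfolding in_pgl_class_iff by (intro exI[of _ 1]) simp

lemma pgl_class_eqI:
  assumes "c \<noteq> 0" shows "pgl_class (mat c ** A) = pgl_class A"
proof -
  have "mat d ** (mat c ** A) = mat (d * c) ** A" for d
    by (simp add: matrix_mul_assoc mat_mult_mat)
  moreover have "mat d ** A = mat (d / c) ** (mat c ** A)" for d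
    using assms by (simp add: matrix_mul_assoc mat_mult_mat)
  ultimately show ?thesis
    using assms by (intro Set.set_eqI) (metis in_pgl_class_iff divide_eq_0_iff mult_eq_0_iff)
qed

lemma pgl_class_eq_iff: "pgl_class A = pgl_class B \<longleftrightarrow> (\<exists>c. c \<noteq> 0 \<and> A = mat c ** B)"
  using self_in_pgl_class[of A] pgl_class_eqI in_pgl_class_iff by metis

lemma carrier_GL: "A \<in> carrier GL \<longleftrightarrow> invertible A"
  by (simp add: GL_def)

lemma carrier_PGL: "carrier PGL = pgl_class ` {A. invertible A}"
  unfolding PGL_def carrier_FactGroup pgl_class_def by (simp add: GL_def)

lemma pgl_class_in_PGL: "invertible A \<Longrightarrow> pgl_class A \<in> carrier PGL"
  by (simp add: carrier_PGL)

lemma pgl_class_mult: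
  assumes "invertible A" "invertible B"
  shows "pgl_class A \<otimes>\<^bsub>PGL\<^esub> pgl_class B = pgl_class (A ** B)"
  using normal.rcos_sum[OF normal_scalar_mats, of A B] assms
  by (simp add: PGL_def pgl_class_def carrier_GL) (simp add: GL_def)

lemma pgl_class_one: "\<one>\<^bsub>PGL\<^esub> = pgl_class (mat 1)"
  by (auto simp: PGL_def scalar_mats_def in_pgl_class_iff)

lemma invertible_pair:
  assumes "A ** B = mat (1 :: complex)" "B ** A = mat 1"
  shows "invertible A" "invertible B"
  using assms by (auto simp: invertible_def)

lemma pgl_class_inv:
  assumes "A ** B = mat 1" "B ** A = mat 1"
  shows "inv\<^bsub>PGL\<^esub> pgl_class A = pgl_class B"
  using assms invertible_pair[OF assms]
  by (intro group.inv_equality[OF group_PGL]) (simp_all add: pgl_class_mult pgl_class_one pgl_class_in_PGL)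

lemma pgl_class_pow:
  fixes A :: "complex ^ 'n ^ 'n" and k :: nat
  assumes "invertible A" shows "pgl_class A [^]\<^bsub>PGL\<^esub> k = pgl_class (A [^]\<^bsub>GL\<^esub> k)"
  unfolding PGL_def pgl_class_def using assms
  by (intro normal.FactGroup_pow[OF normal_scalar_mats]) (simp add: carrier_GL)

lemma (in group) conj_subgroup_eq_image:
  "g <# H #> inv g = (\<lambda>h. g \<otimes> h \<otimes> inv g) ` H"
  by (auto simp: l_coset_def r_coset_def)

lemma (in group) equiv_conjugate_subgroups:
  "equiv {H. subgroup H G} {(H, K). subgroup H G \<and> subgroup K G \<and> (\<exists>g\<in>carrier G. K = g <# H #> inv g)}"
proof (rule equivI)
  let ?R = "{(H, K). subgroup H G \<and> subgroup K G \<and> (\<exists>g\<in>carrier G. K = g <# H #> inv g)}"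
  have comp: "g <# (h <# H #> inv h) #> inv g = (g \<otimes> h) <# H #> inv (g \<otimes> h)"
    if "g \<in> carrier G" "h \<in> carrier G" "subgroup H G" for g h H
    unfolding conj_subgroup_eq_image image_image
    using that subgroup.mem_carrier[OF that(3)]
    by (intro image_cong refl) (simp add: inv_mult_group m_assoc)
  have one: "\<one> <# H #> inv \<one> = H" if "subgroup H G" for H
  proof -
    have "\<one> <# H #> inv \<one> = (\<lambda>h. h) ` H"
      unfolding conj_subgroup_eq_image using subgroup.mem_carrier[OF that]
      by (intro image_cong refl) simp
    then show ?thesis by simp
  qed
  show "?R \<subseteq> {H. subgroup H G} \<times> {H. subgroup H G}" by blast
  show "refl_on {H. subgroup H G} ?R"
    by (rule refl_onI) (use one in fastforce)
  show "sym ?R"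
  proof (rule symI)
    fix H K assume "(H, K) \<in> ?R"
    then obtain g where g: "subgroup H G" "subgroup K G" "g \<in> carrier G" "K = g <# H #> inv g" by blast
    have "H = inv g <# K #> inv (inv g)"
      unfolding g(4) using comp[of "inv g" g H] g(1,3) one[of H] by simp
    then show "(K, H) \<in> ?R" using g(1,2) inv_closed[OF g(3)] by blast
  qed
  show "trans ?R"
  proof (rule transI)
    fix H K L assume "(H, K) \<in> ?R" "(K, L) \<in> ?R"
    then obtain g h where gh: "subgroup H G" "subgroup L G" "g \<in> carrier G" "h \<in> carrier G"
      and K: "K = g <# H #> inv g" and L: "L = h <# K #> inv h" by blast
    have "L = (h \<otimes> g) <# H #> inv (h \<otimes> g)" unfolding L K using gh by (intro comp)
    then show "(H, L) \<in> ?R" using gh(1,2) m_closed[OF gh(4,3)] by blast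
  qed
qed

lemma equiv_conj_rel: "equiv {H. subgroup H PGL} conj_rel"
  unfolding conj_rel_def by (rule group.equiv_conjugate_subgroups[OF group_PGL])

text \<open>
  Conjugation by a pair of mutually inverse matrices avoids inverses in the quotient group.
\<close>

lemma conj_rel_iff:
  fixes H K :: "(complex ^ 'n ^ 'n) set set"
  shows
  "(H, K) \<in> conj_rel \<longleftrightarrow> subgroup H PGL \<and> subgroup K PGL \<and>
    (\<exists>P Q. P ** Q = mat 1 \<and> Q ** P = mat 1 \<and>
      K = (\<lambda>h. pgl_class P \<otimes>\<^bsub>PGL\<^esub> h \<otimes>\<^bsub>PGL\<^esub> pgl_class Q) ` H)"
proof -
  have "(\<exists>g\<in>carrier PGL. K = g <#\<^bsub>PGL\<^esub> H #>\<^bsub>PGL\<^esub> inv\<^bsub>PGL\<^esub> g) \<longleftrightarrow>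
    (\<exists>P Q. P ** Q = mat 1 \<and> Q ** P = mat 1 \<and>
      K = (\<lambda>h. pgl_class P \<otimes>\<^bsub>PGL\<^esub> h \<otimes>\<^bsub>PGL\<^esub> pgl_class Q) ` H)"
    unfolding group.conj_subgroup_eq_image[OF group_PGL]
  proof (intro iffI; clarify)
    fix g :: "(complex ^ 'n ^ 'n) set"
    assume "g \<in> carrier PGL"
    then show "\<exists>P Q. P ** Q = mat 1 \<and> Q ** P = mat 1 \<and>
      (\<lambda>h. g \<otimes>\<^bsub>PGL\<^esub> h \<otimes>\<^bsub>PGL\<^esub> inv\<^bsub>PGL\<^esub> g) ` H
        = (\<lambda>h. pgl_class P \<otimes>\<^bsub>PGL\<^esub> h \<otimes>\<^bsub>PGL\<^esub> pgl_class Q) ` H"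
    proof -
      obtain P where P: "invertible P" "g = pgl_class P" using \<open>g \<in> carrier PGL\<close> unfolding carrier_PGL by blast
      then obtain Q where "P ** Q = mat 1" "Q ** P = mat 1" unfolding invertible_def by blast
      then show ?thesis using pgl_class_inv[of P Q] P(2) by (intro exI[of _ P] exI[of _ Q]) simp
    qed
  next
    fix P Q :: "complex ^ 'n ^ 'n"
    assume PQ: "P ** Q = mat 1" "Q ** P = mat 1"
    show "\<exists>g\<in>carrier PGL. (\<lambda>h. pgl_class P \<otimes>\<^bsub>PGL\<^esub> h \<otimes>\<^bsub>PGL\<^esub> pgl_class Q) ` H
      = (\<lambda>h. g \<otimes>\<^bsub>PGL\<^esub> h \<otimes>\<^bsub>PGL\<^esub> inv\<^bsub>PGL\<^esub> g) ` H"
      using pgl_class_inv[OF PQ] invertible_pair[OF PQ] by (intro bexI[of _ "pgl_class P"]) (simp_all add: pgl_class_in_PGL)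
  qed
  then show ?thesis unfolding conj_rel_def by blast
qed

section \<open>Groups generated by diagonal matrices of order p\<close>

definition diag_mat :: "('n \<Rightarrow> complex) \<Rightarrow> complex ^ 'n ^ 'n" where
  "diag_mat d = (\<chi> i j. if i = j then d i else 0)"

lemma diag_mat_mult_left: "(diag_mat d ** A) $ i $ j = d i * A $ i $ j"
  by (simp add: diag_mat_def matrix_matrix_mult_def if_distrib[of "\<lambda>x. x * _"] sum.delta cong: if_cong)

lemma diag_mat_mult_right: "(A ** diag_mat d) $ i $ j = A $ i $ j * d j"
  by (simp add: diag_mat_def matrix_matrix_mult_def if_distrib[of "\<lambda>x. _ * x"] sum.delta' cong: if_cong)

lemma diag_mat_mult: "diag_mat d ** diag_mat e = diag_mat (\<lambda>i. d i * e i)"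
  by (simp add: vec_eq_iff diag_mat_mult_left) (simp add: diag_mat_def)

lemma mat_eq_diag_mat: "mat c = diag_mat (\<lambda>_. c)"
  by (simp add: mat_def diag_mat_def)

lemma diag_mat_vec: "diag_mat d *v v = (\<chi> i. d i * v $ i)"
  by (simp add: diag_mat_def matrix_vector_mult_def if_distrib[of "\<lambda>x. x * _"] sum.delta cong: if_cong)

lemma diag_mat_eq_iff: "diag_mat d = diag_mat e \<longleftrightarrow> d = e"
  by (auto simp: diag_mat_def vec_eq_iff fun_eq_iff)

lemma invertible_diag_mat: "(\<And>i. d i \<noteq> 0) \<Longrightarrow> invertible (diag_mat d)"
  unfolding invertible_def
  by (intro exI[of _ "diag_mat (\<lambda>i. 1 / d i)"]) (simp add: diag_mat_mult mat_eq_diag_mat)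

context prime_root_of_unity
begin

definition diag_root :: "('n \<Rightarrow> nat) \<Rightarrow> complex ^ 'n ^ 'n" where
  "diag_root a = diag_mat (\<lambda>i. z ^ a i)"

text \<open>
  All natural exponents \<open>k\<close> are admitted, so that closure under products is plain; only \<open>k\<close> modulo \<open>p\<close>
  matters.
\<close>

definition diag_subgroup :: "('n \<Rightarrow> nat) \<Rightarrow> (complex ^ 'n ^ 'n) set set" where
  "diag_subgroup a = range (\<lambda>k. pgl_class (diag_root (\<lambda>i. k * a i)))"

lemma invertible_diag_root [simp]: "invertible (diag_root a)"
  by (simp add: diag_root_def invertible_diag_mat)

lemma diag_root_mult: "diag_root a ** diag_root b = diag_root (\<lambda>i. a i + b i)"
  by (simp add: diag_root_def diag_mat_mult power_add)

lemma diag_root_zero: "diag_root (\<lambda>_. 0) = mat 1"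
  by (simp add: diag_root_def mat_eq_diag_mat)

lemma diag_root_shift: "mat (z ^ t) ** diag_root a = diag_root (\<lambda>i. a i + t)"
  by (simp add: diag_root_def diag_mat_mult mat_eq_diag_mat power_add mult.commute)

lemma diag_root_eq_iff: "diag_root a = diag_root b \<longleftrightarrow> (\<forall>i. [a i = b i] (mod p))"
  by (simp add: diag_root_def diag_mat_eq_iff fun_eq_iff z_pow_eq_iff)

lemma pgl_class_diag_root_eq_one_iff:
  "pgl_class (diag_root a) = \<one>\<^bsub>PGL\<^esub> \<longleftrightarrow> (\<forall>i j. [a i = a j] (mod p))"
proof -
  have "pgl_class (diag_root a) = \<one>\<^bsub>PGL\<^esub> \<longleftrightarrow> (\<exists>c. c \<noteq> 0 \<and> (\<forall>i. z ^ a i = c))"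
    unfolding pgl_class_one pgl_class_eq_iff
    by (simp add: diag_root_def mat_eq_diag_mat diag_mat_mult diag_mat_eq_iff fun_eq_iff)
  also have "\<dots> \<longleftrightarrow> (\<forall>i j. z ^ a i = z ^ a j)"
    by (metis power_not_zero z_ne_0)
  finally show ?thesis by (simp add: z_pow_eq_iff)
qed

lemma pgl_class_diag_root_mult:
  "pgl_class (diag_root a) \<otimes>\<^bsub>PGL\<^esub> pgl_class (diag_root b) = pgl_class (diag_root (\<lambda>i. a i + b i))"
  by (simp add: pgl_class_mult diag_root_mult)

lemma pgl_class_diag_root_pow:
  fixes k :: nat and a :: "'n::finite \<Rightarrow> nat"
  shows "pgl_class (diag_root a) [^]\<^bsub>PGL\<^esub> k = pgl_class (diag_root (\<lambda>i. k * a i))"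
proof (induction k)
  case 0 then show ?case by (simp add: diag_root_zero pgl_class_one)
next
  case (Suc k) then show ?case by (simp add: pgl_class_diag_root_mult add.commute)
qed

lemma pgl_class_diag_root_cong:
  "(\<And>i. [a i = b i] (mod p)) \<Longrightarrow> pgl_class (diag_root a) = pgl_class (diag_root b)"
  using diag_root_eq_iff[of a b] by metis

lemma subgroup_diag_subgroup: "subgroup (diag_subgroup a) PGL"
proof (rule group.subgroupI[OF group_PGL])
  show "diag_subgroup a \<subseteq> carrier PGL" by (auto simp: diag_subgroup_def pgl_class_in_PGL)
  show "diag_subgroup a \<noteq> {}" by (simp add: diag_subgroup_def)
  show "f \<otimes>\<^bsub>PGL\<^esub> g \<in> diag_subgroup a" if "f \<in> diag_subgroup a" "g \<in> diag_subgroup a" for f g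
    using that by (auto simp: diag_subgroup_def pgl_class_diag_root_mult simp flip: distrib_right)
  fix f assume "f \<in> diag_subgroup a"
  then obtain k where k: "f = pgl_class (diag_root (\<lambda>i. k * a i))" by (auto simp: diag_subgroup_def)
  let ?l = "(p - 1) * k"
  have "?l * a i + k * a i = p * (k * a i)" for i
  proof -
    have "?l * a i + k * a i = (p - 1 + 1) * (k * a i)" by (simp add: distrib_right mult.assoc)
    then show ?thesis using p_gt_1 by simp
  qed
  then have "pgl_class (diag_root (\<lambda>i. ?l * a i)) \<otimes>\<^bsub>PGL\<^esub> f = \<one>\<^bsub>PGL\<^esub>"
    unfolding k pgl_class_diag_root_mult pgl_class_diag_root_eq_one_iff by (simp add: cong_def)
  then have "inv\<^bsub>PGL\<^esub> f = pgl_class (diag_root (\<lambda>i. ?l * a i))"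
    using k by (intro group.inv_equality[OF group_PGL]) (auto simp: pgl_class_in_PGL)
  then show "inv\<^bsub>PGL\<^esub> f \<in> diag_subgroup a" by (auto simp: diag_subgroup_def)
qed

lemma diag_subgroup_eq_image:
  "diag_subgroup a = (\<lambda>k. pgl_class (diag_root (\<lambda>i. k * a i))) ` {..<p}"
proof (intro subset_antisym subsetI)
  fix f assume "f \<in> diag_subgroup a"
  then obtain k where "f = pgl_class (diag_root (\<lambda>i. k * a i))" by (auto simp: diag_subgroup_def)
  also have "\<dots> = pgl_class (diag_root (\<lambda>i. (k mod p) * a i))"
    by (intro pgl_class_diag_root_cong) (simp add: cong_def mod_mult_left_eq)
  finally show "f \<in> (\<lambda>k. pgl_class (diag_root (\<lambda>i. k * a i))) ` {..<p}" using p_gt_1 by auto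
qed (auto simp: diag_subgroup_def)

lemma card_diag_subgroup:
  fixes a :: "'n::finite \<Rightarrow> nat"
  assumes "\<not> [a i = a j] (mod p)"
  shows "card (diag_subgroup a) = p"
proof -
  have coprime: "coprime k p" if "\<not> p dvd k" for k
    using prime_imp_coprime[OF prime_p that] by (simp add: coprime_commute)
  have "inj_on (\<lambda>k. pgl_class (diag_root (\<lambda>i. k * a i))) {..<p}"
  proof (rule linorder_inj_onI')
    fix k l assume kl: "k \<in> {..<p}" "l \<in> {..<p}" "k < l"
    show "pgl_class (diag_root (\<lambda>i. k * a i)) \<noteq> pgl_class (diag_root (\<lambda>i. l * a i))"
    proof
      assume eq: "pgl_class (diag_root (\<lambda>i. k * a i)) = pgl_class (diag_root (\<lambda>i. l * a i))"
      obtain m where m: "l = m + k" using kl(3) by (metis less_imp_add_positive add.commute)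
      interpret PGL: group "PGL :: (complex ^ 'n ^ 'n) set monoid" by (rule group_PGL)
      have "\<one>\<^bsub>PGL\<^esub> \<otimes>\<^bsub>PGL\<^esub> pgl_class (diag_root (\<lambda>i. k * a i))
          = pgl_class (diag_root (\<lambda>i. m * a i)) \<otimes>\<^bsub>PGL\<^esub> pgl_class (diag_root (\<lambda>i. k * a i))"
        using eq unfolding m distrib_right pgl_class_diag_root_mult
        by (simp only: PGL.l_one[OF pgl_class_in_PGL[OF invertible_diag_root]])
      then have "pgl_class (diag_root (\<lambda>i. m * a i)) = \<one>\<^bsub>PGL\<^esub>"
        by (simp add: pgl_class_in_PGL)
      then have "[m * a i = m * a j] (mod p)"
        unfolding pgl_class_diag_root_eq_one_iff by blast
      moreover have "\<not> p dvd m" using kl m by (intro not_dvd_if_less) auto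
      ultimately show False using assms coprime by (simp add: cong_mult_lcancel_nat)
    qed
  qed
  then show ?thesis by (simp add: diag_subgroup_eq_image card_image)
qed

lemma cyclic_diag_subgroup: "cyclic_group (PGL\<lparr>carrier := diag_subgroup a\<rparr>)"
proof -
  let ?H = "PGL\<lparr>carrier := diag_subgroup a\<rparr>"
  interpret H: group ?H
    by (rule subgroup.subgroup_is_group[OF subgroup_diag_subgroup group_PGL])
  let ?f = "pgl_class (diag_root a)"
  have f: "?f \<in> carrier ?H" using rangeI[of "\<lambda>k. pgl_class (diag_root (\<lambda>i. k * a i))" 1]
    by (simp add: diag_subgroup_def)
  have "h \<in> range (\<lambda>n::int. ?f [^]\<^bsub>?H\<^esub> n)" if "h \<in> carrier ?H" for h
  proof -
    obtain k where "h = pgl_class (diag_root (\<lambda>i. k * a i))" using \<open>h \<in> _\<close> by (auto simp: diag_subgroup_def)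
    then have "h = ?f [^]\<^bsub>?H\<^esub> k"
      using pgl_class_diag_root_pow[of a k] monoid.nat_pow_consistent[OF group.is_monoid[OF group_PGL]] by metis
    then have "h = ?f [^]\<^bsub>?H\<^esub> int k" by (simp add: int_pow_int)
    then show ?thesis by blast
  qed
  then have "carrier ?H = range (\<lambda>n::int. ?f [^]\<^bsub>?H\<^esub> n)"
    using H.int_pow_closed[OF f] by blast
  then show ?thesis using f unfolding H.cyclic_group by blast
qed

lemma conj_diag_subgroup_image:
  assumes PQ: "P ** Q = mat 1" "Q ** P = mat 1"
  shows "(\<lambda>h. pgl_class P \<otimes>\<^bsub>PGL\<^esub> h \<otimes>\<^bsub>PGL\<^esub> pgl_class Q) ` diag_subgroup a
    = range (\<lambda>k. pgl_class (P ** diag_root (\<lambda>i. k * a i) ** Q))"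
  using invertible_pair[OF PQ]
  by (simp add: diag_subgroup_def image_image pgl_class_mult invertible_mult)

text \<open>
  Conjugation by a permutation matrix permutes the diagonal entries.
\<close>

lemma diag_root_reindex:
  fixes \<sigma> :: "'n::finite \<Rightarrow> 'n" and P Q :: "complex ^ 'n ^ 'n"
  assumes "bij \<sigma>"
  defines "P \<equiv> (\<chi> i j. if j = \<sigma> i then 1 else 0)" and "Q \<equiv> (\<chi> i j. if i = \<sigma> j then 1 else 0)"
  shows "P ** diag_root x ** Q = diag_root (\<lambda>i. x (\<sigma> i))" and "P ** Q = mat 1" and "Q ** P = mat 1"
proof -
  have inj: "\<sigma> i = \<sigma> j \<longleftrightarrow> i = j" for i j using assms(1) by (meson bij_def inj_eq)
  have PDQ: "P ** diag_root x ** Q = diag_root (\<lambda>i. x (\<sigma> i))" for x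
    by (simp add: vec_eq_iff matrix_matrix_mult_def[of _ Q] diag_mat_mult_right diag_root_def)
      (simp add: P_def Q_def diag_mat_def inj if_distrib[of "\<lambda>x. _ * x"] if_distrib[of "\<lambda>x. x * _"]
        sum.delta sum.delta' cong: if_cong)
  then show "P ** diag_root x ** Q = diag_root (\<lambda>i. x (\<sigma> i))" .
  show "P ** Q = mat 1" using PDQ[of "\<lambda>_. 0"] by (simp add: diag_root_zero)
  then show "Q ** P = mat 1" using matrix_left_right_inverse[of P Q] by blast
qed

text \<open>
  If \<open>P\<close> conjugates the \<open>k\<close>-th power of the first generator to a scalar multiple of the second, then
  \<open>z ^ b i = c * z ^ (k * a j)\<close> wherever \<open>P\<close> has a nonzero entry, and an invertible matrix has one in
  each row and each column.  So \<open>c\<close> is a root of unity \<open>z ^ t\<close>, and the exponent sets are related by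
  \<open>s \<mapsto> k s + t\<close>.  Conversely, the factor \<open>k\<close> is a change of generator, the shift \<open>t\<close> a change of
  representative matrix, and the order of the exponents is a permutation of coordinates.
\<close>

lemma diag_subgroup_conj_iff:
  fixes a b :: "'n::finite \<Rightarrow> nat"
  assumes a: "inj a" "range a \<subseteq> {..<p}" and b: "inj b" "range b \<subseteq> {..<p}" and n: "CARD('n) \<ge> 2"
  shows "(diag_subgroup a, diag_subgroup b) \<in> conj_rel \<longleftrightarrow>
    (\<exists>u\<in>{1..<p}. \<exists>t<p. range b = (\<lambda>s. (u * s + t) mod p) ` range a)"
proof
  assume "(diag_subgroup a, diag_subgroup b) \<in> conj_rel"
  then obtain P Q where PQ: "P ** Q = mat 1" "Q ** P = mat 1"
    and eq: "diag_subgroup b = range (\<lambda>k. pgl_class (P ** diag_root (\<lambda>i. k * a i) ** Q))"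
    unfolding conj_rel_iff using conj_diag_subgroup_image by metis
  have "pgl_class (diag_root (\<lambda>i. 1 * b i)) \<in> diag_subgroup b" unfolding diag_subgroup_def by blast
  then obtain k where "pgl_class (diag_root b) = pgl_class (P ** diag_root (\<lambda>i. k * a i) ** Q)"
    unfolding eq by auto
  then obtain c where c: "diag_root b = mat c ** (P ** diag_root (\<lambda>i. k * a i) ** Q)"
    unfolding pgl_class_eq_iff by blast
  have "diag_root b ** P = mat c ** (P ** diag_root (\<lambda>i. k * a i)) ** (Q ** P)"
    unfolding c by (simp add: matrix_mul_assoc)
  then have "(diag_root b ** P) $ i $ j = (mat c ** (P ** diag_root (\<lambda>i. k * a i))) $ i $ j" for i j
    using PQ by simp
  then have entry: "z ^ b i * P $ i $ j = c * (P $ i $ j * z ^ (k * a j))" for i j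
    by (simp add: diag_root_def diag_mat_mult_left diag_mat_mult_right mat_mult_left)
  then have nz: "z ^ b i = c * z ^ (k * a j)" if "P $ i $ j \<noteq> 0" for i j
  proof -
    have "P $ i $ j * z ^ b i = P $ i $ j * (c * z ^ (k * a j))"
      using entry[of i j] by (simp add: mult_ac)
    then show ?thesis using that by simp
  qed
  have row: "\<exists>j. P $ i $ j \<noteq> 0" for i
  proof (rule ccontr)
    assume "\<nexists>j. P $ i $ j \<noteq> 0"
    then have "(P ** Q) $ i $ i = 0" by (simp add: matrix_matrix_mult_def)
    then show False using PQ by (simp add: mat_def)
  qed
  have col: "\<exists>i. P $ i $ j \<noteq> 0" for j
  proof (rule ccontr)
    assume "\<nexists>i. P $ i $ j \<noteq> 0"
    then have "(Q ** P) $ j $ j = 0" by (simp add: matrix_matrix_mult_def)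
    then show False using PQ by (simp add: mat_def)
  qed
  have "c ^ p = 1"
  proof -
    obtain i j where "z ^ b i = c * z ^ (k * a j)" using row nz by blast
    then have "(z ^ b i) ^ p = c ^ p * (z ^ (k * a j)) ^ p" by (simp add: power_mult_distrib)
    moreover have "(z ^ m) ^ p = 1" for m by (simp add: z_pow_eq_1_iff flip: power_mult)
    ultimately show ?thesis by simp
  qed
  then obtain t where t: "t < p" "c = z ^ t" by (rule root_is_z_pow)
  define u where "u = k mod p"
  have link: "b i = (u * a j + t) mod p" if "P $ i $ j \<noteq> 0" for i j
  proof -
    have "z ^ b i = z ^ (k * a j + t)"
      using nz[OF that] by (simp add: t(2) power_add mult.commute)
    then have "b i mod p = (k * a j + t) mod p" by (simp add: z_pow_eq_iff cong_def)
    also have "\<dots> = (u * a j + t) mod p"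
      unfolding u_def by (metis mod_add_left_eq mod_mult_left_eq)
    finally show ?thesis using b(2) by (simp add: subset_iff image_iff) (metis mod_less)
  qed
  have range: "range b = (\<lambda>s. (u * s + t) mod p) ` range a"
    using link row col by (auto simp: image_iff) metis+
  have "u \<noteq> 0"
  proof
    assume "u = 0"
    then have "range b = {t mod p}" unfolding range by auto
    then have "card (range b) \<le> 1" by simp
    moreover have "card (range b) = CARD('n)" using b by (simp add: card_image)
    ultimately show False using n by simp
  qed
  then have "u \<in> {1..<p}" using p_gt_1 by (simp add: u_def)
  then show "\<exists>u\<in>{1..<p}. \<exists>t<p. range b = (\<lambda>s. (u * s + t) mod p) ` range a"
    using t range by blast
next
  assume "\<exists>u\<in>{1..<p}. \<exists>t<p. range b = (\<lambda>s. (u * s + t) mod p) ` range a"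
  then obtain u t where u: "u \<in> {1..<p}" and range: "range b = (\<lambda>s. (u * s + t) mod p) ` range a"
    by blast
  have "\<forall>i. \<exists>j. b i = (u * a j + t) mod p" using range by (auto simp: image_iff set_eq_iff)
  then obtain \<sigma> where \<sigma>: "\<And>i. b i = (u * a (\<sigma> i) + t) mod p" by metis
  have "inj \<sigma>" using b(1) \<sigma> by (metis injD injI)
  then have "bij \<sigma>" by (simp add: bij_def finite_UNIV_inj_surj)
  define P :: "complex ^ 'n ^ 'n" where "P = (\<chi> i j. if j = \<sigma> i then 1 else 0)"
  define Q :: "complex ^ 'n ^ 'n" where "Q = (\<chi> i j. if i = \<sigma> j then 1 else 0)"
  note PQ = diag_root_reindex[OF \<open>bij \<sigma>\<close>, folded P_def Q_def]
  have b_conj: "pgl_class (diag_root (\<lambda>i. k * b i)) = pgl_class (P ** diag_root (\<lambda>i. k * u * a i) ** Q)" for k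
  proof -
    have "[k * b i = k * u * a (\<sigma> i) + k * t] (mod p)" for i
    proof -
      have "[k * b i = k * (u * a (\<sigma> i) + t)] (mod p)"
        unfolding \<sigma>[of i] by (intro cong_mult cong_refl) (simp add: cong_def)
      then show ?thesis by (simp add: distrib_left mult.assoc)
    qed
    then have "pgl_class (diag_root (\<lambda>i. k * b i)) = pgl_class (mat (z ^ (k * t)) ** diag_root (\<lambda>i. k * u * a (\<sigma> i)))"
      unfolding diag_root_shift by (rule pgl_class_diag_root_cong)
    also have "\<dots> = pgl_class (diag_root (\<lambda>i. k * u * a (\<sigma> i)))" by (rule pgl_class_eqI) simp
    finally show ?thesis by (simp only: PQ(1))
  qed
  obtain v where v: "[u * v = 1] (mod p)"
    using prime_p u not_dvd_if_less by (metis One_nat_def cong_solve_coprime_nat coprime_commute prime_imp_coprime)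
  have "pgl_class (P ** diag_root (\<lambda>i. k * a i) ** Q) = pgl_class (diag_root (\<lambda>i. (k * v) * b i))" for k
  proof -
    have "[k * v * u * a i = k * a i] (mod p)" for i
    proof -
      have "[k * a i * (u * v) = k * a i * 1] (mod p)" using v by (intro cong_mult cong_refl)
      then show ?thesis by (simp add: mult_ac)
    qed
    then have "diag_root (\<lambda>i. k * v * u * a i) = diag_root (\<lambda>i. k * a i)"
      by (simp add: diag_root_eq_iff)
    then show ?thesis unfolding b_conj by simp
  qed
  then have "diag_subgroup b = range (\<lambda>k. pgl_class (P ** diag_root (\<lambda>i. k * a i) ** Q))"
    unfolding diag_subgroup_def using b_conj by auto
  then show "(diag_subgroup a, diag_subgroup b) \<in> conj_rel"
    unfolding conj_rel_iff using PQ(2,3) conj_diag_subgroup_image[OF PQ(2,3)] subgroup_diag_subgroup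
    by metis
qed

end

section \<open>Points in general position\<close>

abbreviation point :: "complex ^ 'n \<Rightarrow> (complex ^ 'n) set" where
  "point v \<equiv> vec.span {v}"

lemma span_Union_points: "vec.span (\<Union>(point ` W)) = vec.span (W :: (complex ^ 'n) set)"
proof -
  have "point w \<subseteq> vec.span W" if "w \<in> W" for w
    using that by (intro vec.span_mono) auto
  moreover have "W \<subseteq> vec.span (\<Union>(point ` W))"
    using vec.span_superset[of "{_}"] vec.span_superset[of "\<Union>(point ` W)"] by blast
  ultimately show ?thesis unfolding vec.span_eq by blast
qed

text \<open>
  General position in terms of representative vectors; \<open>general_positionI\<close> is the converse.
\<close>

lemma general_position_imp_independent:
  fixes W :: "(complex ^ 'n) set"
  assumes "general_position T" "point ` W \<subseteq> T" "inj_on point W" "finite W" "card W \<le> CARD('n)"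
  shows "vec.independent W"
proof -
  have "card (point ` W) = card W" using assms(3) by (rule card_image)
  then have "vec.dim (vec.span (\<Union>(point ` W))) = card W"
    using assms unfolding general_position_def by (metis finite_imageI)
  then have "vec.dim W = card W" unfolding span_Union_points by (simp only: vec.dim_span)
  then show ?thesis
    using assms(4) vec.span_superset by (intro vec.card_le_dim_spanning[of W W]) auto
qed

lemma general_positionI:
  fixes V :: "(complex ^ 'n) set"
  assumes n: "CARD('n) \<ge> 2"
    and indep: "\<And>W. W \<subseteq> V \<Longrightarrow> finite W \<Longrightarrow> card W \<le> CARD('n) \<Longrightarrow> vec.independent W"
  shows "general_position (point ` V)" and "inj_on point V"
proof -
  have nz: "v \<noteq> 0" if "v \<in> V" for v
    using indep[of "{v}"] n that by auto
  show inj: "inj_on point V"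
  proof (rule inj_onI, rule ccontr)
    fix v w assume vw: "v \<in> V" "w \<in> V" "point v = point w" "v \<noteq> w"
    then have "vec.independent {v, w}" using n by (intro indep) auto
    moreover have "v \<in> point w" using vw(3) vec.span_superset[of "{v}"] by blast
    ultimately show False using vw(4) unfolding vec.dependent_def by (auto simp: insert_Diff_if)
  qed
  show "general_position (point ` V)"
    unfolding general_position_def
  proof (intro conjI allI impI)
    show "point ` V \<subseteq> proj_space" using nz by (auto simp: proj_space_def)
    fix S assume S: "S \<subseteq> point ` V" "finite S \<and> card S \<le> CARD('n)"
    then obtain W where W: "W \<subseteq> V" "S = point ` W" by (meson subset_imageE)
    have inj_W: "inj_on point W" using inj W(1) by (rule inj_on_subset)
    then have "finite W" "card W = card S" using S(2) W(2) by (simp_all add: finite_image_iff card_image)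
    then have "vec.independent W" using indep W(1) S(2) by simp
    then show "vec.dim (vec.span (\<Union>S)) = card S"
      unfolding W(2) span_Union_points
      using \<open>card W = card S\<close> W(2) by (simp add: vec.dim_eq_card_independent)
  qed
qed

lemma pgl_act_point: "pgl_act (pgl_class A) (point v) = point (A *v v)"
  unfolding pgl_class_def by (rule pgl_act_coset)

section \<open>Diagonal groups with distinct exponents are admissible\<close>

context prime_root_of_unity
begin

text \<open>
  The orbit of the all-ones vector under the powers of the diagonal matrix with exponents \<open>a\<close>.
\<close>

definition root_vec :: "('n \<Rightarrow> nat) \<Rightarrow> nat \<Rightarrow> complex ^ 'n" where
  "root_vec a k = (\<chi> i. z ^ (k * a i))"

lemma diag_root_root_vec: "diag_root (\<lambda>i. l * a i) *v root_vec a k = root_vec a (k + l)"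
  by (simp add: diag_root_def diag_mat_vec root_vec_def vec_eq_iff flip: power_add) (simp add: algebra_simps)

lemma root_vec_cong: "[k = l] (mod p) \<Longrightarrow> root_vec a k = root_vec a l"
  by (simp add: root_vec_def vec_eq_iff z_pow_eq_iff cong_scalar_right)

lemma range_root_vec: "range (root_vec a) = root_vec a ` {..<p}"
proof -
  have "root_vec a k \<in> root_vec a ` {..<p}" for k
    using root_vec_cong[of k "k mod p" a] p_gt_1 by (auto simp: cong_def)
  then show ?thesis by blast
qed

lemma inj_on_root_vec:
  fixes a :: "'n::finite \<Rightarrow> nat"
  assumes "\<not> p dvd a i"
  shows "inj_on (root_vec a) {..<p}"
proof (rule inj_onI)
  fix k l assume kl: "k \<in> {..<p}" "l \<in> {..<p}" "root_vec a k = root_vec a l"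
  then have "z ^ (k * a i) = z ^ (l * a i)" by (simp add: root_vec_def vec_eq_iff)
  then have "[k * a i = l * a i] (mod p)" by (simp add: z_pow_eq_iff)
  moreover have "coprime (a i) p"
    using prime_imp_coprime[OF prime_p assms] by (simp add: coprime_commute)
  ultimately have "[k = l] (mod p)" by (simp add: cong_mult_rcancel_nat)
  then show "k = l" using kl cong_less_modulus_unique_nat by blast
qed

text \<open>
  In a linear relation, every coordinate gives the vanishing of a polynomial, with coefficients indexed
  by the \<open>root_vec a k\<close> involved, at the root \<open>z ^ a i\<close>.  If the coordinate vector takes part, the
  coordinate \<open>i0\<close> is lost, but so is one of the \<open>root_vec a k\<close>; in both cases \<open>chebotarev\<close> applies.
\<close>

lemma independent_root_vecs:
  fixes a :: "'n::finite \<Rightarrow> nat" and i0 :: 'n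
  assumes a: "inj a" "range a \<subseteq> {..<p}" "\<not> p dvd a i1"
    and W: "W \<subseteq> insert (axis i0 1) (range (root_vec a))" "card W \<le> CARD('n)"
  shows "vec.independent W"
proof -
  let ?e = "axis i0 1 :: complex ^ 'n" and ?x = "root_vec a"
  have finW: "finite W" using W(1) unfolding range_root_vec by (rule finite_subset) simp
  have "u w = 0" if rel: "(\<Sum>v\<in>W. u v *s v) = 0" and "w \<in> W" for u w
  proof -
    define K where "K = {k \<in> {..<p}. ?x k \<in> W - {?e}}"
    define I where "I = (if ?e \<in> W then UNIV - {i0} else UNIV)"
    have inj_K: "inj_on ?x K" using inj_on_root_vec[of a i1, OF a(3)] by (rule inj_on_subset) (auto simp: K_def)
    have "W - {?e} \<subseteq> ?x ` {..<p}" using W(1) unfolding range_root_vec by blast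
    then have W_e: "W - {?e} = ?x ` K"
      unfolding K_def by (intro subset_antisym subsetI) (erule subset_imageE, auto)
    have card_I: "card I = (if ?e \<in> W then CARD('n) - 1 else CARD('n))"
      by (simp add: I_def card_Diff_singleton)
    have "card K = card (W - {?e})" unfolding W_e using inj_K by (simp add: card_image)
    also have "\<dots> \<le> card I"
      unfolding card_I using W(2) finW by (auto simp: card_Diff_singleton)
    also have "\<dots> = card (a ` I)" using a(1) by (intro card_image[symmetric] inj_on_subset[OF a(1)]) auto
    finally have card_K: "card K \<le> card (a ` I)" .
    have coord: "(\<Sum>k\<in>K. u (?x k) * z ^ (a i * k)) = 0" if "i \<in> I" for i
    proof -
      have "(\<Sum>k\<in>K. u (?x k) * z ^ (a i * k)) = (\<Sum>v\<in>W - {?e}. (u v *s v) $ i)"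
        unfolding W_e sum.reindex[OF inj_K] by (simp add: root_vec_def mult.commute)
      also have "\<dots> = (\<Sum>v\<in>W. (u v *s v) $ i)"
      proof (rule sum.mono_neutral_left)
        show "\<forall>v\<in>W - (W - {?e}). (u v *s v) $ i = 0"
          using that by (auto simp: I_def axis_def split: if_splits)
      qed (use finW in auto)
      also have "\<dots> = (\<Sum>v\<in>W. u v *s v) $ i" by simp
      finally show ?thesis unfolding rel by simp
    qed
    have zero_K: "u (?x k) = 0" if "k \<in> K" for k
    proof (rule chebotarev[of K "a ` I" "\<lambda>k. u (?x k)"])
      show "(\<Sum>k\<in>K. u (?x k) * z ^ (m * k)) = 0" if "m \<in> a ` I" for m
        using that coord by blast
    qed (use card_K that a(2) in \<open>auto simp: K_def\<close>)
    show "u w = 0"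
    proof (cases "w = ?e")
      case False
      then have "w \<in> ?x ` K" using \<open>w \<in> W\<close> unfolding W_e[symmetric] by simp
      then show ?thesis using zero_K by auto
    next
      case True
      have "(\<Sum>v\<in>W. u v *s v) = u ?e *s ?e + (\<Sum>v\<in>W - {?e}. u v *s v)"
        using True \<open>w \<in> W\<close> finW by (simp add: sum.remove)
      also have "(\<Sum>v\<in>W - {?e}. u v *s v) = 0" unfolding W_e using zero_K by (intro sum.neutral) auto
      finally have "u ?e *s ?e = 0" unfolding rel by simp
      then have "(u ?e *s ?e) $ i0 = 0" by simp
      then show ?thesis using True by simp
    qed
  qed
  then show ?thesis unfolding vec.independent_explicit using finW by blast
qed

text \<open>
  The coordinate point is added to the orbit because for \<open>p = CARD('n) + 1\<close> the \<open>p\<close> points of the orbit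
  alone are one too few.
\<close>

lemma diag_subgroup_admissible:
  fixes a :: "'n::finite \<Rightarrow> nat"
  assumes a: "inj a" "range a \<subseteq> {..<p}" and n: "CARD('n) \<ge> 2" "p > CARD('n)"
  shows "diag_subgroup a \<in> admissible_cyclic p"
proof -
  obtain i j :: 'n where ij: "i \<noteq> j"
    using n(1) by (metis card_1_singleton_iff UNIV_I ex_card card_2_iff' )
  then have "a i \<noteq> a j" using a(1) by (simp add: inj_eq)
  then have noncong: "\<not> [a i = a j] (mod p)"
    using a(2) cong_less_modulus_unique_nat[of "a i" "a j" p] by auto
  then obtain i1 where i1: "\<not> p dvd a i1" by (metis cong_def dvd_eq_mod_eq_0)
  have card: "card (diag_subgroup a) = p" using noncong by (rule card_diag_subgroup)
  let ?e = "axis i 1 :: complex ^ 'n" and ?x = "root_vec a"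
  define V where "V = insert ?e (range ?x)"
  have indep: "vec.independent W" if "W \<subseteq> V" "card W \<le> CARD('n)" for W
    using that unfolding V_def by (rule independent_root_vecs[of a i1, OF a i1])
  have gp: "general_position (point ` V)" "inj_on point V"
    by (rule general_positionI[OF n(1)], rule indep, assumption+)+
  have "?e \<notin> range ?x"
  proof
    assume "?e \<in> range ?x"
    then obtain k where "?e = ?x k" by blast
    then have "?e $ j = ?x k $ j" by simp
    then show False using ij by (simp add: axis_def root_vec_def)
  qed
  then have card_V: "card V = p + 1"
    unfolding V_def range_root_vec using inj_on_root_vec[of a i1, OF i1] by (simp add: card_image)
  have "pgl_act f ` point ` V = point ` V" if f: "f \<in> diag_subgroup a" for f
  proof -
    obtain l where l: "f = pgl_class (diag_root (\<lambda>i. l * a i))" using f by (auto simp: diag_subgroup_def)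
    have shift: "pgl_act f (point (?x k)) = point (?x (k + l))" for k
      by (simp add: l pgl_act_point diag_root_root_vec)
    have e: "pgl_act f (point ?e) = point ?e"
    proof -
      have "diag_root (\<lambda>i. l * a i) *v ?e = z ^ (l * a i) *s ?e"
        by (simp add: diag_root_def diag_mat_vec vec_eq_iff axis_def)
      moreover have "point (z ^ (l * a i) *s ?e) = point ?e"
        by (rule vec.span_image_scale[of "{?e}" "\<lambda>_. z ^ (l * a i)", simplified])
      ultimately show ?thesis by (simp add: l pgl_act_point)
    qed
    have "point (?x k) \<in> pgl_act f ` point ` V" for k
    proof -
      \<comment> \<open>Shifting by \<open>(p - 1) * l\<close> undoes shifting by \<open>l\<close>.\<close>
      have eq: "(k + (p - 1) * l) + l = k + p * l"
        using p_gt_1 by (metis add.assoc add.commute le_add_diff_inverse2 less_imp_le_nat mult_Suc plus_1_eq_Suc)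
      have "?x ((k + (p - 1) * l) + l) = ?x k"
        unfolding eq by (intro root_vec_cong) (simp add: cong_def)
      then have "point (?x k) = pgl_act f (point (?x (k + (p - 1) * l)))" by (simp only: shift)
      then show ?thesis unfolding V_def by blast
    qed
    moreover have "point ?e \<in> pgl_act f ` point ` V"
      using imageI[of "point ?e" "point ` V" "pgl_act f"] e by (simp add: V_def)
    ultimately have "point v \<in> pgl_act f ` point ` V" if "v \<in> V" for v
      using that by (auto simp only: V_def insert_iff image_iff)
    then have "point ` V \<subseteq> pgl_act f ` point ` V" by (rule image_subsetI)
    moreover have "pgl_act f ` point ` V \<subseteq> point ` V" using e shift unfolding V_def by auto
    ultimately show ?thesis by blast
  qed
  then have "diag_subgroup a \<subseteq> Aut_pts (point ` V)"
    unfolding Aut_pts_def using subgroup.mem_carrier[OF subgroup_diag_subgroup[of a]]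
    by (simp add: subset_iff)
  moreover have "card (point ` V) = p + 1" using card_image[OF gp(2)] card_V by simp
  moreover have "finite (point ` V)" "finite (diag_subgroup a)"
    by (simp_all add: V_def range_root_vec diag_subgroup_eq_image)
  ultimately have "admissible (diag_subgroup a)"
    unfolding admissible_def using subgroup_diag_subgroup[of a] gp(1) n(2)
    by (intro conjI exI[of _ "point ` V"]) auto
  then show ?thesis
    unfolding admissible_cyclic_def using card cyclic_diag_subgroup[of a] by simp
qed

end

section \<open>Admissible groups of order p are diagonalizable\<close>

lemma (in group) prime_order_generator:
  assumes p: "prime (order G)" and x: "x \<in> carrier G" "x \<noteq> \<one>"
  shows "x [^] order G = \<one>" and "carrier G = range (\<lambda>k::nat. x [^] k)"
proof -
  have fin: "finite (carrier G)"
    using p by (metis card.infinite not_prime_0 order_def)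
  have "ord x dvd order G" using x(1) by (rule ord_dvd_group_order)
  moreover have "ord x \<noteq> 1" using ord_eq_1[OF x(1)] x(2) by simp
  ultimately have ord: "ord x = order G" using p by (metis prime_nat_iff)
  then show "x [^] order G = \<one>" using pow_ord_eq_1[OF x(1)] by simp
  have gen: "generate G {x} = {x [^] k | k. k \<in> (UNIV :: nat set)}"
    using generate_pow_nat[OF x(1)] ord p by (metis not_prime_0)
  have "generate G {x} = carrier G"
  proof (rule card_subset_eq[OF fin])
    show "generate G {x} \<subseteq> carrier G" using generate_incl[of "{x}"] x(1) by simp
    show "card (generate G {x}) = card (carrier G)"
      using generate_pow_card[OF x(1)] ord by (simp add: order_def)
  qed
  then show "carrier G = range (\<lambda>k::nat. x [^] k)" unfolding gen by (simp add: full_SetCompr_eq)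
qed

lemma GL_simps:
  "A \<otimes>\<^bsub>GL\<^esub> B = A ** B" "\<one>\<^bsub>GL\<^esub> = mat 1"
  by (simp_all add: GL_def)

lemma GL_pow_add: "invertible A \<Longrightarrow> A [^]\<^bsub>GL\<^esub> (k + l :: nat) = A [^]\<^bsub>GL\<^esub> k ** A [^]\<^bsub>GL\<^esub> l"
  using monoid.nat_pow_mult[OF group.is_monoid[OF group_GL], of A k l]
  by (simp add: GL_simps carrier_GL)

lemma GL_pow_mult: "invertible A \<Longrightarrow> (A [^]\<^bsub>GL\<^esub> (k::nat)) [^]\<^bsub>GL\<^esub> (l::nat) = A [^]\<^bsub>GL\<^esub> (k * l)"
  by (rule monoid.nat_pow_pow[OF group.is_monoid[OF group_GL]]) (simp add: carrier_GL)

lemma GL_pow_1: "invertible A \<Longrightarrow> A [^]\<^bsub>GL\<^esub> (1::nat) = A"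
  by (simp add: GL_simps)

lemma GL_pow_smult: "(mat d ** A) [^]\<^bsub>GL\<^esub> (k::nat) = mat (d ^ k) ** A [^]\<^bsub>GL\<^esub> k"
proof (induction k)
  case (Suc k)
  have "(mat d ** A) [^]\<^bsub>GL\<^esub> Suc k = mat (d ^ k) ** (A [^]\<^bsub>GL\<^esub> k ** mat d) ** A"
    using Suc by (simp add: GL_simps matrix_mul_assoc)
  also have "\<dots> = mat (d ^ k) ** mat d ** (A [^]\<^bsub>GL\<^esub> k ** A)"
    unfolding mat_commute[of "A [^]\<^bsub>GL\<^esub> k" d] by (simp only: matrix_mul_assoc)
  finally show ?case by (simp add: GL_simps mat_mult_mat mult.commute)
qed (simp add: GL_simps)

lemma matrix_vec_scale: "A *v (c *s x) = c *s (A *v (x :: complex ^ 'n))"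
  by (simp add: vec.scale_sum_right matrix_vector_mult_def vec_eq_iff sum_distrib_left mult_ac)

lemma matrix_vec_sum: "A *v (\<Sum>i\<in>I. f i) = (\<Sum>i\<in>I. A *v (f i :: complex ^ 'n))"
  by (induction I rule: infinite_finite_induct) (simp_all add: matrix_vector_right_distrib)

lemma mat_vec: "mat c *v x = c *s (x :: complex ^ 'n)"
  by (simp add: mat_eq_diag_mat diag_mat_vec vec_eq_iff)

text \<open>
  Choose \<open>CARD('n) + 1\<close> of the points.  Their representatives are eigenvectors of \<open>A\<close>, and they satisfy a
  linear relation in which, by general position, every coefficient is nonzero.  Applying \<open>A - l x\<close> to
  the relation removes \<open>x\<close> and leaves a relation among independent vectors, so every other eigenvalue
  equals \<open>l x\<close>; the eigenvectors other than \<open>x\<close> already form a basis.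
\<close>

lemma scalar_if_all_points_fixed:
  fixes A :: "complex ^ 'n ^ 'n"
  assumes gp: "general_position T" and T: "finite T" "card T > CARD('n)"
    and fixed: "\<And>P. P \<in> T \<Longrightarrow> pgl_act (pgl_class A) P = P"
  shows "\<exists>c. A = mat c"
proof -
  obtain T' where T': "T' \<subseteq> T" "card T' = CARD('n) + 1" "finite T'"
    using obtain_subset_with_card_n[of "CARD('n) + 1" T] T by auto
  have "\<exists>v. P = point v" if "P \<in> T" for P
    using gp that by (auto simp: general_position_def proj_space_def)
  then obtain r where r: "\<And>P. P \<in> T \<Longrightarrow> point (r P) = P" by metis
  define V where "V = r ` T'"
  have pr: "point (r P) = P" if "P \<in> T'" for P using that r T'(1) by blast
  have inj_r: "inj_on r T'" by (rule inj_on_inverseI[of _ point]) (rule pr)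
  have V: "card V = CARD('n) + 1" "finite V" using T' inj_r by (simp_all add: V_def card_image)
  have point_V: "point v \<in> T" if "v \<in> V" for v using that pr T'(1) by (auto simp: V_def)
  have inj_V: "inj_on point V" by (rule inj_onI) (auto simp: V_def pr)
  have indep: "vec.independent W" if "W \<subseteq> V" "card W \<le> CARD('n)" for W
    using that point_V V(2)
    by (intro general_position_imp_independent[OF gp] inj_on_subset[OF inj_V]) (auto intro: finite_subset)
  have "\<exists>l. A *v v = l *s v" if "v \<in> V" for v
  proof -
    have "A *v v \<in> point (A *v v)" using vec.span_superset[of "{A *v v}"] by blast
    also have "\<dots> = point v" using fixed[OF point_V[OF that]] by (simp only: pgl_act_point)
    finally show ?thesis by (auto simp: vec.span_singleton)
  qed
  then obtain l where l: "\<And>v. v \<in> V \<Longrightarrow> A *v v = l v *s v" by metis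
  have "vec.dependent V"
  proof (rule ccontr)
    assume "vec.independent V"
    then have "card V \<le> vec.dim (UNIV :: (complex ^ 'n) set)"
      by (intro vec.independent_card_le_dim) auto
    then show False using V(1) by (simp add: vec_dim_card card_cart_basis)
  qed
  then obtain u x where x: "x \<in> V" "u x \<noteq> 0" and rel: "(\<Sum>v\<in>V. u v *s v) = 0"
    using vec.dependent_finite[OF V(2)] by blast
  have card_minus: "card (V - {y}) = CARD('n)" if "y \<in> V" for y using that V by simp
  have u_nz: "u y \<noteq> 0" if "y \<in> V" for y
  proof
    assume "u y = 0"
    then have "(\<Sum>v\<in>V - {y}. u v *s v) = 0"
      using rel that V(2) by (simp add: sum.remove)
    moreover have "vec.independent (V - {y})" using that card_minus by (intro indep) auto
    ultimately have "\<forall>v\<in>V - {y}. u v = 0" unfolding vec.independent_explicit by blast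
    then show False using x \<open>u y = 0\<close> by blast
  qed
  have "(\<Sum>v\<in>V - {x}. (u v * (l v - l x)) *s v) = (\<Sum>v\<in>V. (u v * (l v - l x)) *s v)"
    using x(1) V(2) by (simp add: sum.remove)
  also have "\<dots> = A *v (\<Sum>v\<in>V. u v *s v) - l x *s (\<Sum>v\<in>V. u v *s v)"
    unfolding matrix_vec_sum vec.scale_sum_right sum_subtractf[symmetric]
    by (intro sum.cong refl) (simp add: matrix_vec_scale l vec.scale_left_diff_distrib algebra_simps)
  also have "\<dots> = 0" unfolding rel by simp
  finally have rel': "(\<Sum>v\<in>V - {x}. (u v * (l v - l x)) *s v) = 0" .
  have ind: "vec.independent (V - {x})" using x(1) card_minus by (intro indep) auto
  have l_eq: "l v = l x" if "v \<in> V - {x}" for v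
    using ind rel' that u_nz unfolding vec.independent_explicit by fastforce
  have "UNIV \<subseteq> vec.span (V - {x})"
    using ind card_minus[OF x(1)] by (intro vec.card_ge_dim_independent) (auto simp: vec_dim_card card_cart_basis)
  have "A *v w = mat (l x) *v w" for w
  proof -
    have "w \<in> vec.span (V - {x})" using \<open>UNIV \<subseteq> _\<close> by blast
    then show ?thesis
    proof (induction rule: vec.span_induct_alt)
      case base then show ?case by simp
    next
      case (step c v y)
      have "A *v v = mat (l x) *v v" using l[of v] l_eq[of v] step(1) by (simp add: mat_vec)
      then show ?case using step(2) by (simp add: matrix_vector_right_distrib matrix_vec_scale)
    qed
  qed
  then show ?thesis by (metis matrix_eq)
qed

context prime_root_of_unity
begin

text \<open>
  The vectors \<open>e m\<close> are \<open>p\<close> times the projections of \<open>v\<close> to the eigenspaces of \<open>A\<close> for \<open>z ^ m\<close>, by the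
  finite Fourier transform along the orbit of \<open>v\<close>.  They span the same space as the orbit, that is, the
  whole space, so a basis can be selected from them; different basis vectors belong to different \<open>m\<close>.
\<close>

lemma diagonalize:
  fixes A :: "complex ^ 'n ^ 'n"
  assumes A: "invertible A" "A [^]\<^bsub>GL\<^esub> p = mat 1"
    and indep: "vec.independent ((\<lambda>k. A [^]\<^bsub>GL\<^esub> k *v v) ` {..<CARD('n)})"
    and inj: "inj_on (\<lambda>k. A [^]\<^bsub>GL\<^esub> k *v v) {..<CARD('n)}"
  obtains a :: "'n \<Rightarrow> nat" and P Q where "inj a" "range a \<subseteq> {..<p}" "P ** Q = mat 1" "Q ** P = mat 1"
    "A = P ** diag_root a ** Q"
proof -
  let ?B = "\<lambda>k. A [^]\<^bsub>GL\<^esub> (k::nat)"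
  define e where "e m = (\<Sum>k<p. (1 / z ^ m) ^ k *s (?B k *v v))" for m
  have A_B: "A *v (?B k *v v) = ?B (Suc k) *v v" for k
    using GL_pow_add[OF A(1), of 1 k] unfolding GL_pow_1[OF A(1)]
    by (simp only: plus_1_eq_Suc matrix_vector_mul_assoc)
  have eigen: "A *v e m = z ^ m *s e m" for m
  proof -
    define g where "g k = (1 / z ^ m) ^ k *s (?B k *v v)" for k
    \<comment> \<open>The summands are periodic in \<open>k\<close>, so shifting \<open>k\<close> by one does not change the sum.\<close>
    have "g p = g 0"
    proof -
      have "(1 / z ^ m) ^ p = 1"
        by (simp add: power_divide z_pow_eq_1_iff flip: power_mult)
      then show ?thesis by (simp add: g_def A(2) GL_simps)
    qed
    then have "(\<Sum>k<p. g (Suc k)) = e m"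
      using sum.lessThan_Suc_shift[of g p] by (simp add: e_def g_def)
    moreover have "A *v e m = (\<Sum>k<p. z ^ m *s g (Suc k))"
      unfolding e_def matrix_vec_sum
      by (intro sum.cong refl) (simp add: matrix_vec_scale A_B g_def vec.scale_scale del: nat_pow_Suc)
    ultimately show ?thesis by (simp only: vec.scale_sum_right[symmetric])
  qed
  have eigen_pow: "?B k *v e m = (z ^ m) ^ k *s e m" for k m
  proof (induction k)
    case (Suc k)
    have "?B (Suc k) *v e m = ?B k *v (A *v e m)" by (simp add: GL_simps matrix_vector_mul_assoc)
    then show ?case using Suc by (simp add: eigen matrix_vec_scale vec.scale_scale mult.commute)
  qed (simp add: GL_simps)
  \<comment> \<open>Orthogonality of characters leaves only the term \<open>k = 0\<close>.\<close>
  have sum_e: "(\<Sum>m<p. e m) = of_nat p *s v"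
  proof -
    have "(\<Sum>m<p. e m) = (\<Sum>k<p. (\<Sum>m<p. (1 / z ^ m) ^ k) *s (?B k *v v))"
      unfolding e_def vec.scale_sum_left by (rule sum.swap)
    also have "\<dots> = (\<Sum>k\<in>{0}. (\<Sum>m<p. (1 / z ^ m) ^ k) *s (?B k *v v))"
    proof (rule sum.mono_neutral_right)
      show "\<forall>k\<in>{..<p} - {0}. (\<Sum>m<p. (1 / z ^ m) ^ k) *s (?B k *v v) = 0"
      proof
        fix k assume k: "k \<in> {..<p} - {0}"
        have "(1 / z ^ m) ^ k = (1 / z ^ k) ^ m" for m
          by (simp add: power_divide mult.commute flip: power_mult)
        moreover have "1 / z ^ k \<noteq> 1" using k by (auto simp: z_pow_eq_1_iff dest: dvd_imp_le)
        moreover have "(1 / z ^ k) ^ p = 1"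
          by (simp add: power_divide z_pow_eq_1_iff flip: power_mult)
        ultimately have "(\<Sum>m<p. (1 / z ^ m) ^ k) = 0" by (simp add: sum_gp_strict)
        then show "(\<Sum>m<p. (1 / z ^ m) ^ k) *s (?B k *v v) = 0" by simp
      qed
    qed (use p_gt_1 in auto)
    finally show ?thesis by (simp add: GL_simps)
  qed
  have B_span: "?B k *v v \<in> vec.span (e ` {..<p})" for k
  proof -
    have "of_nat p *s (?B k *v v) = (\<Sum>m<p. (z ^ m) ^ k *s e m)"
      by (simp add: sum_e matrix_vec_scale matrix_vec_sum flip: eigen_pow)
        (simp add: sum_e matrix_vec_scale flip: matrix_vec_sum)
    also have "\<dots> \<in> vec.span (e ` {..<p})"
      by (intro vec.span_sum vec.span_scale vec.span_base) auto
    finally have "(1 / of_nat p) *s (of_nat p *s (?B k *v v)) \<in> vec.span (e ` {..<p})"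
      by (rule vec.span_scale)
    then show ?thesis using p_gt_1 by (simp add: vec.scale_scale)
  qed
  let ?W = "(\<lambda>k. ?B k *v v) ` {..<CARD('n)}"
  have "UNIV \<subseteq> vec.span ?W"
    using indep card_image[OF inj] by (intro vec.card_ge_dim_independent) (auto simp: vec_dim_card card_cart_basis)
  moreover have "vec.span ?W \<subseteq> vec.span (e ` {..<p})"
    using B_span by (intro vec.span_minimal vec.subspace_span) auto
  ultimately have span_e: "vec.span (e ` {..<p}) = UNIV" by blast
  obtain E where E: "E \<subseteq> e ` {..<p}" "vec.independent E" "e ` {..<p} \<subseteq> vec.span E"
    using vec.maximal_independent_subset by blast
  have span_E: "vec.span E = UNIV"
    using vec.span_minimal[OF E(3) vec.subspace_span] span_e by blast
  have card_E: "card E = CARD('n)"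
    using vec.basis_card_eq_dim[of E UNIV] E(2) span_E by (simp add: vec_dim_card card_cart_basis)
  have "finite E" using E(1) by (rule finite_subset) simp
  then obtain b :: "'n \<Rightarrow> complex ^ 'n" where b: "bij_betw b UNIV E"
    using finite_same_card_bij[of "UNIV :: 'n set" E] card_E by auto
  have "\<exists>m<p. e m = b i" for i
  proof -
    have "b i \<in> e ` {..<p}" using b E(1) by (auto simp: bij_betw_def)
    then show ?thesis by auto
  qed
  then obtain a where a: "\<And>i. a i < p" "\<And>i. e (a i) = b i" by metis
  have "inj a" using a(2) b by (metis bij_betw_def injD injI)
  define P :: "complex ^ 'n ^ 'n" where "P = (\<chi> r i. b i $ r)"
  have col: "column i P = b i" for i by (simp add: P_def column_def)
  have "columns P = E" using b by (auto simp: columns_def col bij_betw_def)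
  then obtain Q where Q: "P ** Q = mat 1" using matrix_right_invertible_span_columns[of P] span_E by auto
  then have Q': "Q ** P = mat 1" using matrix_left_right_inverse[of P Q] by blast
  have "A ** P = P ** diag_root a"
  proof -
    have "(A ** P) $ r $ i = (P ** diag_root a) $ r $ i" for r i
    proof -
      have "(A ** P) $ r $ i = (A *v b i) $ r"
        by (simp add: matrix_matrix_mult_def matrix_vector_mult_def P_def)
      also have "\<dots> = z ^ a i * b i $ r" using eigen[of "a i"] a(2)[of i] by simp
      finally show ?thesis by (simp add: diag_root_def diag_mat_mult_right P_def)
    qed
    then show ?thesis by (simp add: vec_eq_iff)
  qed
  then have "P ** diag_root a ** Q = A ** (P ** Q)" by (simp add: matrix_mul_assoc)
  then have "A = P ** diag_root a ** Q" using Q by simp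
  with \<open>inj a\<close> a(1) Q Q' show thesis by (intro that) auto
qed

end

context prime_root_of_unity
begin

text \<open>
  The group is generated by the class of a matrix \<open>A\<close> which, after rescaling by a \<open>p\<close>-th root, satisfies
  \<open>A\<^sup>p = 1\<close>.  A point moved by \<open>A\<close> has \<open>p\<close> different images under the powers of \<open>A\<close>, as \<open>p\<close> is prime, and
  \<open>CARD('n)\<close> of them give the cyclic vector that \<open>diagonalize\<close> needs.
\<close>

lemma admissible_cyclic_conj_diag_subgroup:
  fixes H :: "(complex ^ 'n ^ 'n) set set"
  assumes H: "H \<in> admissible_cyclic p" and n: "p > CARD('n)"
  shows "\<exists>a. inj a \<and> range a \<subseteq> {..<p} \<and> (diag_subgroup a, H) \<in> conj_rel"
proof -
  interpret PGL: group "PGL :: (complex ^ 'n ^ 'n) set monoid" by (rule group_PGL)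
  have sub: "subgroup H PGL" and card_H: "card H = p"
    using H by (auto simp: admissible_cyclic_def admissible_def)
  obtain T where T: "finite T" "card T \<ge> CARD('n) + 2" "general_position T" "H \<subseteq> Aut_pts T"
    using H by (auto simp: admissible_cyclic_def admissible_def)
  let ?H = "PGL\<lparr>carrier := H\<rparr>"
  interpret H: group ?H by (rule subgroup.subgroup_is_group[OF sub group_PGL])
  have "\<not> H \<subseteq> {\<one>\<^bsub>PGL\<^esub>}"
    using card_H p_gt_1 card_mono[of "{\<one>\<^bsub>PGL\<^esub>}" H] by auto
  then obtain f where f: "f \<in> H" "f \<noteq> \<one>\<^bsub>PGL\<^esub>" by blast
  have order_H: "order ?H = p" by (simp add: order_def card_H)
  have pow_H: "g [^]\<^bsub>?H\<^esub> k = g [^]\<^bsub>PGL\<^esub> k" for g and k :: nat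
    by (rule PGL.nat_pow_consistent[symmetric])
  have gen: "f [^]\<^bsub>PGL\<^esub> p = \<one>\<^bsub>PGL\<^esub>" "H = range (\<lambda>k::nat. f [^]\<^bsub>PGL\<^esub> k)"
    using H.prime_order_generator[of f] f prime_p unfolding order_H pow_H by simp_all
  have "f \<in> carrier PGL" using f(1) subgroup.mem_carrier[OF sub] by blast
  then obtain A0 where A0: "invertible A0" "f = pgl_class A0" unfolding carrier_PGL by blast
  obtain c where c: "c \<noteq> 0" "A0 [^]\<^bsub>GL\<^esub> p = mat c"
    using gen(1) unfolding A0(2) pgl_class_pow[OF A0(1)] pgl_class_one pgl_class_eq_iff by auto
  obtain d where d: "d ^ p = 1 / c"
  proof -
    have "card {d. d ^ p = 1 / c} = p" using c(1) p_gt_1 by (intro card_nth_roots) auto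
    then have "{d. d ^ p = 1 / c} \<noteq> {}" using p_gt_1 by (metis card.empty not_one_less_zero)
    then show thesis using that by blast
  qed
  have "d \<noteq> 0" using d c(1) p_gt_1 by (auto simp: power_0_left)
  define A where "A = mat d ** A0"
  have f_A: "f = pgl_class A" unfolding A_def A0(2) by (rule pgl_class_eqI[OF \<open>d \<noteq> 0\<close>, symmetric])
  have A_inv: "invertible A"
    unfolding A_def using A0(1) \<open>d \<noteq> 0\<close>
    by (intro invertible_mult) (simp_all add: mat_eq_diag_mat invertible_diag_mat)
  have A_p: "A [^]\<^bsub>GL\<^esub> p = mat 1"
    using c d by (simp add: A_def GL_pow_smult mat_mult_mat)
  let ?B = "\<lambda>k::nat. A [^]\<^bsub>GL\<^esub> k"
  have f_pow: "f [^]\<^bsub>PGL\<^esub> k = pgl_class (?B k)" for k :: nat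
    unfolding f_A by (rule pgl_class_pow[OF A_inv])
  have stable: "pgl_act (pgl_class (?B k)) P \<in> T" if "P \<in> T" for k P
  proof -
    have "pgl_class (?B k) \<in> H" using gen(2) f_pow by auto
    then show ?thesis using T(4) that by (auto simp: Aut_pts_def)
  qed
  have "\<not> (\<forall>P\<in>T. pgl_act (pgl_class A) P = P)"
  proof
    assume "\<forall>P\<in>T. pgl_act (pgl_class A) P = P"
    then obtain c where c: "A = mat c" using scalar_if_all_points_fixed[OF T(3,1), of A] T(2) by auto
    have "c \<noteq> 0"
    proof
      assume "c = 0"
      obtain B where "A ** B = mat 1" using A_inv by (auto simp: invertible_def)
      then have "(A ** B) $ i $ i = 1" for i by (simp add: mat_def)
      then show False using \<open>c = 0\<close> by (simp add: c mat_mult_left)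
    qed
    then have "f = \<one>\<^bsub>PGL\<^esub>" unfolding f_A c pgl_class_one using pgl_class_eqI[of c "mat 1"] by simp
    then show False using f(2) by simp
  qed
  then obtain P0 where P0: "P0 \<in> T" "pgl_act (pgl_class A) P0 \<noteq> P0" by blast
  then obtain v where "P0 = point v"
    using T(3) by (auto simp: general_position_def proj_space_def)
  with P0 have v: "point v \<in> T" "point (A *v v) \<noteq> point v" by (simp_all add: pgl_act_point)
  have act: "pgl_act (pgl_class (?B k)) (point (?B l *v v)) = point (?B (k + l) *v v)" for k l
    by (simp add: pgl_act_point GL_pow_add[OF A_inv] matrix_vector_mul_assoc)
  have not_fixed: "point (?B m *v v) \<noteq> point v" if m: "m \<in> {1..<p}" for m
  proof
    assume eq: "point (?B m *v v) = point v"
    have fixed: "point (?B (m * j) *v v) = point v" for j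
    proof (induction j)
      case (Suc j)
      have "point (?B (m * Suc j) *v v) = pgl_act (pgl_class (?B m)) (point (?B (m * j) *v v))"
        by (simp only: act mult_Suc_right)
      also have "\<dots> = point v" unfolding Suc using eq by (simp add: pgl_act_point)
      finally show ?case .
    qed (simp add: GL_simps)
    have "coprime m p"
      using prime_imp_coprime[OF prime_p not_dvd_if_less[OF m]] by (simp add: coprime_commute)
    then obtain j where j: "[m * j = 1] (mod p)" using cong_solve_coprime_nat by (metis One_nat_def)
    \<comment> \<open>\<open>A\<close> is itself a power of its \<open>m\<close>-th power, so it would fix the point as well.\<close>
    then have "m * j mod p = 1" using p_gt_1 by (simp add: cong_def)
    then obtain q where "m * j = p * q + 1" by (metis mult_div_mod_eq)
    moreover have "?B (p * q) = mat 1"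
    proof -
      have "?B (p * q) = (mat 1) [^]\<^bsub>GL\<^esub> q" using GL_pow_mult[OF A_inv, of p q] A_p by simp
      also have "\<dots> = mat 1"
        using monoid.nat_pow_one[OF group.is_monoid[OF group_GL]] by (simp add: GL_simps)
      finally show ?thesis .
    qed
    ultimately have "?B (m * j) = A" by (simp only: GL_pow_add[OF A_inv] GL_pow_1[OF A_inv] matrix_mul_lid)
    then show False using fixed[of j] v(2) by simp
  qed
  have point_inj: "point (?B k *v v) \<noteq> point (?B l *v v)" if kl: "k < l" "l < p" for k l
  proof
    assume eq: "point (?B k *v v) = point (?B l *v v)"
    have "point (?B (p - k + k) *v v) = point (?B (p - k + l) *v v)"
      using arg_cong[OF eq, of "pgl_act (pgl_class (?B (p - k)))"] unfolding act .
    moreover have "p - k + k = p" "p - k + l = (l - k) + p" using kl by auto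
    moreover have "?B ((l - k) + p) = ?B (l - k)" unfolding GL_pow_add[OF A_inv] A_p by simp
    ultimately have "point v = point (?B (l - k) *v v)"
      by (simp only: A_p matrix_vector_mul_lid)
    moreover have "l - k \<in> {1..<p}" using kl by auto
    ultimately show False using not_fixed by metis
  qed
  have inj_point: "inj_on (\<lambda>k. point (?B k *v v)) {..<p}"
    by (rule linorder_inj_onI') (use point_inj in auto)
  let ?W = "(\<lambda>k. ?B k *v v) ` {..<CARD('n)}"
  have inj_n: "inj_on (\<lambda>k. point (?B k *v v)) {..<CARD('n)}"
    using inj_point by (rule inj_on_subset) (use n in auto)
  have inj_W: "inj_on (\<lambda>k. ?B k *v v) {..<CARD('n)}"
    using inj_n by (auto simp: inj_on_def)
  have "vec.independent ?W"
  proof (rule general_position_imp_independent[OF T(3)])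
    show "point ` ?W \<subseteq> T" using stable[OF v(1)] by (auto simp: pgl_act_point)
    show "inj_on point ?W" using inj_n by (auto simp: inj_on_def)
    show "card ?W \<le> CARD('n)" by (metis card_image_le card_lessThan finite_lessThan)
  qed simp
  from diagonalize[OF A_inv A_p this inj_W]
  obtain a :: "'n \<Rightarrow> nat" and P Q where a: "inj a" "range a \<subseteq> {..<p}"
    and PQ: "P ** Q = mat 1" "Q ** P = mat 1" and A: "A = P ** diag_root a ** Q" .
  have B: "?B k = P ** diag_root (\<lambda>i. k * a i) ** Q" for k
  proof (induction k)
    case 0 then show ?case by (simp add: GL_simps diag_root_zero PQ)
  next
    case (Suc k)
    have "?B (Suc k) = ?B k ** A" by (simp add: GL_simps)
    also have "\<dots> = P ** diag_root (\<lambda>i. k * a i) ** (Q ** P) ** diag_root a ** Q"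
      unfolding Suc by (subst A) (simp only: matrix_mul_assoc)
    also have "\<dots> = P ** (diag_root (\<lambda>i. k * a i) ** diag_root a) ** Q"
      unfolding PQ by (simp add: matrix_mul_assoc)
    finally show ?case by (simp add: diag_root_mult add.commute)
  qed
  have "H = (\<lambda>h. pgl_class P \<otimes>\<^bsub>PGL\<^esub> h \<otimes>\<^bsub>PGL\<^esub> pgl_class Q) ` diag_subgroup a"
    unfolding conj_diag_subgroup_image[OF PQ] gen(2) f_pow B ..
  then have "(diag_subgroup a, H) \<in> conj_rel"
    unfolding conj_rel_iff using PQ sub subgroup_diag_subgroup[of a] by blast
  then show ?thesis using a by blast
qed

end

section \<open>Conjugacy classes and affine orbits\<close>

lemma card_image_eq_if_same_kernel:
  assumes "\<And>x y. x \<in> E \<Longrightarrow> y \<in> E \<Longrightarrow> g x = g y \<longleftrightarrow> h x = h y"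
  shows "card (g ` E) = card (h ` E)"
proof -
  have "bij_betw (\<lambda>w. h (inv_into E g w)) (g ` E) (h ` E)"
  proof (rule bij_betwI[where g = "\<lambda>w. g (inv_into E h w)"])
    have *: "inv_into E g (g x) \<in> E" "h (inv_into E g (g x)) = h x"
      "inv_into E h (h x) \<in> E" "g (inv_into E h (h x)) = g x" if "x \<in> E" for x
    proof -
      show "inv_into E g (g x) \<in> E" "inv_into E h (h x) \<in> E" using that by (auto intro: inv_into_into)
      then show "h (inv_into E g (g x)) = h x" "g (inv_into E h (h x)) = g x"
        using assms that by (metis f_inv_into_f imageI)+
    qed
    show "(\<lambda>w. h (inv_into E g w)) \<in> g ` E \<rightarrow> h ` E" "(\<lambda>w. g (inv_into E h w)) \<in> h ` E \<rightarrow> g ` E"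
      using * by auto
    show "g (inv_into E h (h (inv_into E g w))) = w" if "w \<in> g ` E" for w using that * by auto
    show "h (inv_into E g (g (inv_into E h w))) = w" if "w \<in> h ` E" for w using that * by auto
  qed
  then show ?thesis by (rule bij_betw_same_card)
qed

lemma affine_orbit_eq_iff:
  assumes p: "prime p" and S: "S \<in> subsets_of_card p m" "S' \<in> subsets_of_card p m"
  defines "orb \<equiv> orbit (affine_group p) (affine_action p m)"
  shows "orb S = orb S' \<longleftrightarrow> S' \<in> orb S"
proof -
  interpret group_action "affine_group p" "subsets_of_card p m" "affine_action p m"
    by (rule group_action_affine[OF p])
  have closed: "X \<in> subsets_of_card p m" if "X \<in> orb Y" "Y \<in> subsets_of_card p m" for X Y
    using orbits_coverture that unfolding orb_def orbits_def by blast
  show ?thesis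
  proof
    assume "orb S = orb S'" then show "S' \<in> orb S" using orbit_refl[OF S(2)] by (simp add: orb_def)
  next
    assume S': "S' \<in> orb S"
    then have "S \<in> orb S'" using orbit_sym[OF S] by (simp add: orb_def)
    then show "orb S = orb S'"
      using S' closed[OF _ S(1)] closed[OF _ S(2)] orbit_trans S unfolding orb_def
      by (meson subset_antisym subsetI)
  qed
qed

text \<open>
  Send a set of exponents to the class of the diagonal group with these exponents in some order.  The
  two classifications, by conjugacy and by affine orbit, then have the same kernel on the exponent sets.
\<close>

lemma card_conj_classes_eq_card_affine_orbits:
  assumes p: "prime p" and n: "CARD('n) \<ge> 2" "p > CARD('n)"
  shows "card ((admissible_cyclic p :: (complex ^ 'n ^ 'n) set set set) // conj_rel)
    = card (orbits (affine_group p) (subsets_of_card p CARD('n)) (affine_action p CARD('n)))"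
proof -
  let ?E = "subsets_of_card p CARD('n)" and ?R = "conj_rel :: ((complex ^ 'n ^ 'n) set set \<times> _) set"
  let ?orb = "orbit (affine_group p) (affine_action p CARD('n))"
  have "\<exists>z::complex. z ^ p = 1 \<and> z \<noteq> 1"
  proof (rule ccontr)
    assume "\<nexists>z::complex. z ^ p = 1 \<and> z \<noteq> 1"
    then have "{z::complex. z ^ p = 1} = {1}" by auto
    moreover have "card {z::complex. z ^ p = 1} = p"
      using p prime_gt_0_nat by (intro card_roots_unity_eq) auto
    ultimately show False using prime_gt_1_nat[OF p] by simp
  qed
  then obtain z :: complex where "z ^ p = 1" "z \<noteq> 1" by blast
  then interpret prime_root_of_unity p z using p by unfold_locales
  have "\<exists>a :: 'n \<Rightarrow> nat. inj a \<and> range a = S" if "S \<in> ?E" for S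
  proof -
    have "finite S" "card S = CARD('n)"
      using that by (auto simp: subsets_of_card_def intro: finite_subset)
    then obtain a where "bij_betw a (UNIV :: 'n set) S"
      using finite_same_card_bij[of "UNIV :: 'n set" S] by auto
    then show ?thesis by (auto simp: bij_betw_def)
  qed
  then obtain en :: "nat set \<Rightarrow> 'n \<Rightarrow> nat" where en: "\<And>S. S \<in> ?E \<Longrightarrow> inj (en S) \<and> range (en S) = S"
    by metis
  have sub: "range (en S) \<subseteq> {..<p}" if "S \<in> ?E" for S
    using that en[OF that] by (simp add: subsets_of_card_def)
  have conj_iff: "(diag_subgroup (en S), diag_subgroup (en S')) \<in> ?R \<longleftrightarrow> S' \<in> ?orb S"
    if "S \<in> ?E" "S' \<in> ?E" for S S'
    using diag_subgroup_conj_iff[of "en S" "en S'"] en sub that n(1) in_affine_orbit_iff[OF that(1), of S']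
    by simp
  note eq_class = eq_equiv_class_iff[OF equiv_conj_rel]
  define F where "F S = ?R `` {diag_subgroup (en S)}" for S
  have "admissible_cyclic p // ?R = F ` ?E"
  proof (intro subset_antisym subsetI)
    fix C assume "C \<in> admissible_cyclic p // ?R"
    then obtain H where H: "H \<in> admissible_cyclic p" "C = ?R `` {H}" by (auto elim: quotientE)
    obtain a where a: "inj a" "range a \<subseteq> {..<p}" "(diag_subgroup a, H) \<in> ?R"
      using admissible_cyclic_conj_diag_subgroup[OF H(1) n(2)] by blast
    have S: "range a \<in> ?E" using a by (simp add: subsets_of_card_def card_image)
    \<comment> \<open>The enumeration chosen for \<open>range a\<close> may differ from \<open>a\<close>, but it has the same range.\<close>
    have "range (en (range a)) = (\<lambda>s. (1 * s + 0) mod p) ` range a"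
    proof -
      have "(\<lambda>s. (1 * s + 0) mod p) ` range a = (\<lambda>s. s) ` range a"
        using a(2) by (intro image_cong) auto
      then show ?thesis using en[OF S] by simp
    qed
    then have "(diag_subgroup a, diag_subgroup (en (range a))) \<in> ?R"
      using diag_subgroup_conj_iff[OF a(1,2), of "en (range a)"] en[OF S] sub[OF S] n(1) p_gt_1
      by (metis One_nat_def Suc_leI atLeastLessThan_iff le_refl less_imp_le_nat prime_gt_0_nat p)
    then have "C = F (range a)"
      unfolding H(2) F_def using a(3) equiv_conj_rel by (metis equiv_class_eq)
    then show "C \<in> F ` ?E" using S by blast
  next
    fix C assume "C \<in> F ` ?E"
    then obtain S where S: "S \<in> ?E" "C = F S" by blast
    have "diag_subgroup (en S) \<in> admissible_cyclic p"
      using diag_subgroup_admissible[of "en S"] en[OF S(1)] sub[OF S(1)] n by simp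
    then show "C \<in> admissible_cyclic p // ?R" unfolding S(2) F_def by (rule quotientI)
  qed
  then have "card (admissible_cyclic p // ?R) = card (F ` ?E)" by simp
  also have "\<dots> = card (?orb ` ?E)"
  proof (rule card_image_eq_if_same_kernel)
    fix S S' assume SS': "S \<in> ?E" "S' \<in> ?E"
    have "F S = F S' \<longleftrightarrow> (diag_subgroup (en S), diag_subgroup (en S')) \<in> ?R"
      unfolding F_def by (rule eq_class) (simp_all add: subgroup_diag_subgroup)
    then show "F S = F S' \<longleftrightarrow> ?orb S = ?orb S'"
      using conj_iff[OF SS'] affine_orbit_eq_iff[OF p SS'] by simp
  qed
  also have "?orb ` ?E = orbits (affine_group p) ?E (affine_action p CARD('n))"
    by (auto simp: orbits_def)
  finally show ?thesis .
qed

theorem theorem4: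
  fixes p :: nat and \<Phi> \<alpha> \<beta> \<delta> N :: real
  assumes "prime p" and "p \<ge> 7"
    and "\<Phi> = (real p - 2) * (real p - 3) * (real p - 4) * (real p - 5)"
    and "\<alpha> = 15 * (real p - 3) * (real p - 5)"
    and "\<beta> = 15 * (real p - 3) * (real p - 5) - 120"
    and "\<delta> = 2 * (real p - 4) * 20 - 120"
    and "N = real (card ((admissible_cyclic p :: (complex ^ 6 ^ 6) set set set) // conj_rel))"
  shows "(\<not> [p = 1] (mod 5) \<and> \<not> [p = 1] (mod 3) \<longrightarrow>
            N = \<alpha> / 360 + (\<Phi> - \<alpha>) / 720)
       \<and> ([p = 1] (mod 5) \<and> \<not> [p = 1] (mod 3) \<longrightarrow>
            N = 1 + \<alpha> / 360 + (\<Phi> - 144 - \<alpha>) / 720)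
       \<and> (\<not> [p = 1] (mod 5) \<and> [p = 1] (mod 3) \<longrightarrow>
            N = 1 + \<beta> / 360 + \<delta> / 240 + (\<Phi> - 120 - \<beta> - \<delta>) / 720)
       \<and> ([p = 1] (mod 5) \<and> [p = 1] (mod 3) \<longrightarrow>
            N = 2 + \<beta> / 360 + \<delta> / 240 + (\<Phi> - 120 - 144 - \<beta> - \<delta>) / 720)"
proof -
  have "card ((admissible_cyclic p :: (complex ^ 6 ^ 6) set set set) // conj_rel)
      = card (orbits (affine_group p) (subsets_of_card p 6) (affine_action p 6))"
    using card_conj_classes_eq_card_affine_orbits[OF assms(1), where 'n = 6] assms(2) by simp
  then have "N = \<Phi> / 720 + \<alpha> / 720
      + (if [p = 1] (mod 3) then (real p - 4) / 9 + 1 / 3 else 0)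
      + (if [p = 1] (mod 5) then 4 / 5 else 0)"
    using card_affine_orbits_six[OF assms(1,2)] unfolding assms(3,4,7) by simp
  moreover have "\<beta> = \<alpha> - 120" "\<delta> = 40 * (real p - 4) - 120" using assms(4-6) by simp_all
  ultimately show ?thesis by (auto simp: field_simps)
qed

end
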